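(* Let $(\mathcal C,\otimes,\mathbf I)$ be a strict monoidal category. Let $(V_i,\mu_i,\nu_i)_{1\le i\le r}$ be unital associative algebras in $\mathcal C$, each $\nu_i$ being part of a normalized pair $(\nu_i,\epsilon_i)$, and let $\xi_{i,j}\colon V_i\otimes V_j\to V_j\otimes V_i$ ($1\le i<j\le r$) be morphisms natural with respect to $\nu_i$ and $\nu_j$, such that, with $\xi_{i,i}:=\sigma_{Ass}(V_i)=\nu_i\otimes\mu_i$, the data $(\overline V,\overline\xi,\overline\nu)=((V_i)_i;(\xi_{i,j})_{i\le j};(\nu_i)_i)$ form a pointed braided system. Let $\overleftarrow V=V_r\otimes\cdots\otimes V_1$ be the corresponding braided tensor product, i.e. the unital associative algebra with $$\mu_{\overleftarrow V}=(\mu_r\otimes\cdots\otimes\mu_1)\,\xi_{1,2}^{2r-2}(\xi_{2,3}^{2r-4}\xi_{1,3}^{2r-3})\cdots(\xi_{r-1,r}^{2}\cdots\xi_{2,r}^{r-1}\xi_{1,r}^{r}),\qquad \nu_{\overleftarrow V}=\nu_r\otimes\cdots\otimes\nu_1 .$$ Then the category of right modules over the pointed braided system $(\overline V,\overline\xi,\overline\nu)$ is equivalent to the category of right modules over the algebra $\overleftarrow V$: $$\mathbf{Mod}_{(\overline V,\overline\xi,\overline\nu)}\simeq\mathbf{Mod}_{(\overleftarrow V,\mu_{\overleftarrow V},\nu_{\overleftarrow V})}.$$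
   Context: $\mathrm{Id}_i=\mathrm{Id}_{V_i}$; $\xi_{i,j}^p$ is $\xi_{i,j}$ applied at tensor positions $p,p+1$ (identities elsewhere); juxtaposition is composition. A rank $r$ braided system in $\mathcal C$ is an ordered family $V_1,\dots,V_r$ with morphisms $\sigma_{i,j}\colon V_i\otimes V_j\to V_j\otimes V_i$, $i\le j$ (not necessarily invertible), satisfying $(\sigma_{j,k}\otimes \mathrm{Id}_i)(\mathrm{Id}_j\otimes\sigma_{i,k})(\sigma_{i,j}\otimes\mathrm{Id}_k)=(\mathrm{Id}_k\otimes\sigma_{i,j})(\sigma_{i,k}\otimes\mathrm{Id}_j)(\mathrm{Id}_i\otimes\sigma_{j,k})$ on $V_i\otimes V_j\otimes V_k$ for all $i\le j\le k$. It is pointed if endowed with morphisms $\nu_i\colon\mathbf I\to V_i$. A right module over a pointed braided system $(\overline V,\overline\sigma,\overline\nu)$ is an object $M$ with morphisms $\rho_i\colon M\otimes V_i\to M$, $1\le i\le r$, such that $\rho_j(\rho_i\otimes\mathrm{Id}_j)=\rho_i(\rho_j\otimes\mathrm{Id}_i)(\mathrm{Id}_M\otimes\sigma_{i,j})$ for all $i\le j$, and $\rho_i(\mathrm{Id}_M\otimes\nu_i)=\mathrm{Id}_M$ for all $i$. Module morphisms are morphisms of $\mathcal C$ commuting with all the $\rho_i$. Normalized pair: $\epsilon_i\nu_i=\mathrm{Id}_{\mathbf I}$. Naturality of $\xi_{i,j}$ w.r.t. the units: $\xi_{i,j}(\nu_i\otimes\mathrm{Id}_j)=\mathrm{Id}_j\otimes\nu_i$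 and $\xi_{i,j}(\mathrm{Id}_i\otimes\nu_j)=\nu_j\otimes\mathrm{Id}_i$. It is known that under these hypotheses $\mu_{\overleftarrow V},\nu_{\overleftarrow V}$ define a unital associative algebra. *)

theory Defs
  imports Main "HOL-Library.FuncSet"
begin

section \<open>Categories, functors, equivalence\<close>

text \<open>Objects and morphisms are elements of arbitrary types; a morphism determines its source
  and its target.  Composition \<open>g \<cdot> f\<close> (first \<open>f\<close>, then \<open>g\<close>) is only meaningful when
  \<open>tgt f = src g\<close>.\<close>

record ('o, 'm) cat =
  obj :: "'o set"
  arr :: "'m set"
  src :: "'m \<Rightarrow> 'o"
  tgt :: "'m \<Rightarrow> 'o"
  idn :: "'o \<Rightarrow> 'm"
  cmp :: "'m \<Rightarrow> 'm \<Rightarrow> 'm"  (infixr "\<cdot>\<index>" 65)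

definition hom :: "('o, 'm, 'z) cat_scheme \<Rightarrow> 'o \<Rightarrow> 'o \<Rightarrow> 'm set" where
  "hom C a b = {f \<in> arr C. src C f = a \<and> tgt C f = b}"

locale category =
  fixes C :: "('o, 'm, 'z) cat_scheme" (structure)
  assumes src_obj: "f \<in> arr C \<Longrightarrow> src C f \<in> obj C"
    and tgt_obj: "f \<in> arr C \<Longrightarrow> tgt C f \<in> obj C"
    and idn_hom: "a \<in> obj C \<Longrightarrow> idn C a \<in> hom C a a"
    and cmp_hom: "\<lbrakk>f \<in> hom C a b; g \<in> hom C b c\<rbrakk> \<Longrightarrow> g \<cdot> f \<in> hom C a c"
    and cmp_idn_left: "f \<in> hom C a b \<Longrightarrow> idn C b \<cdot> f = f"
    and cmp_idn_right: "f \<in> hom C a b \<Longrightarrow> f \<cdot> idn C a = f"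
    and cmp_assoc: "\<lbrakk>f \<in> hom C a b; g \<in> hom C b c; h \<in> hom C c d\<rbrakk> \<Longrightarrow> (h \<cdot> g) \<cdot> f = h \<cdot> (g \<cdot> f)"

definition is_iso :: "('o, 'm, 'z) cat_scheme \<Rightarrow> 'm \<Rightarrow> bool" where
  "is_iso C f \<longleftrightarrow> f \<in> arr C \<and>
     (\<exists>g \<in> hom C (tgt C f) (src C f).
        g \<cdot>\<^bsub>C\<^esub> f = idn C (src C f) \<and> f \<cdot>\<^bsub>C\<^esub> g = idn C (tgt C f))"

definition is_functor ::
  "('o, 'm, 'z) cat_scheme \<Rightarrow> ('p, 'n, 'y) cat_scheme \<Rightarrow> ('o \<Rightarrow> 'p) \<Rightarrow> ('m \<Rightarrow> 'n) \<Rightarrow> bool" where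
  "is_functor C D Fo Fa \<longleftrightarrow> category C \<and> category D \<and>
     (\<forall>a \<in> obj C. Fo a \<in> obj D) \<and>
     (\<forall>f \<in> arr C. Fa f \<in> hom D (Fo (src C f)) (Fo (tgt C f))) \<and>
     (\<forall>a \<in> obj C. Fa (idn C a) = idn D (Fo a)) \<and>
     (\<forall>f \<in> arr C. \<forall>g \<in> arr C. tgt C f = src C g \<longrightarrow> Fa (g \<cdot>\<^bsub>C\<^esub> f) = Fa g \<cdot>\<^bsub>D\<^esub> Fa f)"

definition is_natural_iso ::
  "('o, 'm, 'z) cat_scheme \<Rightarrow> ('p, 'n, 'y) cat_scheme \<Rightarrow> ('o \<Rightarrow> 'p) \<Rightarrow> ('m \<Rightarrow> 'n) \<Rightarrow>
     ('o \<Rightarrow> 'p) \<Rightarrow> ('m \<Rightarrow> 'n) \<Rightarrow> ('o \<Rightarrow> 'n) \<Rightarrow> bool" where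
  "is_natural_iso C D Fo Fa Go Ga \<eta> \<longleftrightarrow>
     is_functor C D Fo Fa \<and> is_functor C D Go Ga \<and>
     (\<forall>a \<in> obj C. \<eta> a \<in> hom D (Fo a) (Go a) \<and> is_iso D (\<eta> a)) \<and>
     (\<forall>f \<in> arr C. \<eta> (tgt C f) \<cdot>\<^bsub>D\<^esub> Fa f = Ga f \<cdot>\<^bsub>D\<^esub> \<eta> (src C f))"

definition equivalent_categories ::
  "('o, 'm, 'z) cat_scheme \<Rightarrow> ('p, 'n, 'y) cat_scheme \<Rightarrow> bool" where
  "equivalent_categories C D \<longleftrightarrow>
     (\<exists>Fo Fa Go Ga \<eta> \<theta>.
        is_functor C D Fo Fa \<and> is_functor D C Go Ga \<and>
        is_natural_iso C C (\<lambda>a. a) (\<lambda>f. f) (Go \<circ> Fo) (Ga \<circ> Fa) \<eta> \<and>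
        is_natural_iso D D (Fo \<circ> Go) (Fa \<circ> Ga) (\<lambda>b. b) (\<lambda>g. g) \<theta>)"


section \<open>Strict monoidal categories\<close>

record ('o, 'm) moncat = "('o, 'm) cat" +
  tobj :: "'o \<Rightarrow> 'o \<Rightarrow> 'o"  (infixr "\<boxtimes>\<index>" 70)
  tarr :: "'m \<Rightarrow> 'm \<Rightarrow> 'm"  (infixr "\<otimes>\<index>" 70)
  tunit :: "'o"

locale strict_monoidal_category = category C
  for C :: "('o, 'm, 'z) moncat_scheme" (structure) +
  assumes tunit_obj: "tunit C \<in> obj C"
    and tobj_obj: "\<lbrakk>a \<in> obj C; b \<in> obj C\<rbrakk> \<Longrightarrow> a \<boxtimes> b \<in> obj C"
    and tarr_hom: "\<lbrakk>f \<in> hom C a b; g \<in> hom C c d\<rbrakk> \<Longrightarrow> f \<otimes> g \<in> hom C (a \<boxtimes> c) (b \<boxtimes> d)"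
    and tarr_idn: "\<lbrakk>a \<in> obj C; b \<in> obj C\<rbrakk> \<Longrightarrow> idn C a \<otimes> idn C b = idn C (a \<boxtimes> b)"
    and tarr_cmp: "\<lbrakk>f \<in> hom C a b; f' \<in> hom C b c; g \<in> hom C a' b'; g' \<in> hom C b' c'\<rbrakk>
        \<Longrightarrow> (f' \<cdot> f) \<otimes> (g' \<cdot> g) = (f' \<otimes> g') \<cdot> (f \<otimes> g)"
    and tobj_assoc: "\<lbrakk>a \<in> obj C; b \<in> obj C; c \<in> obj C\<rbrakk> \<Longrightarrow> (a \<boxtimes> b) \<boxtimes> c = a \<boxtimes> (b \<boxtimes> c)"
    and tobj_unit_left: "a \<in> obj C \<Longrightarrow> tunit C \<boxtimes> a = a"
    and tobj_unit_right: "a \<in> obj C \<Longrightarrow> a \<boxtimes> tunit C = a"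
    and tarr_assoc: "\<lbrakk>f \<in> arr C; g \<in> arr C; h \<in> arr C\<rbrakk> \<Longrightarrow> (f \<otimes> g) \<otimes> h = f \<otimes> (g \<otimes> h)"
    and tarr_unit_left: "f \<in> arr C \<Longrightarrow> idn C (tunit C) \<otimes> f = f"
    and tarr_unit_right: "f \<in> arr C \<Longrightarrow> f \<otimes> idn C (tunit C) = f"

definition tobjs :: "('o, 'm, 'z) moncat_scheme \<Rightarrow> 'o list \<Rightarrow> 'o" where
  "tobjs C as = foldr (tobj C) as (tunit C)"

definition tarrs :: "('o, 'm, 'z) moncat_scheme \<Rightarrow> 'm list \<Rightarrow> 'm" where
  "tarrs C fs = foldr (tarr C) fs (idn C (tunit C))"


section \<open>Algebras and pointed braided systems\<close>

definition unital_assoc_algebra ::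
  "('o, 'm, 'z) moncat_scheme \<Rightarrow> 'o \<Rightarrow> 'm \<Rightarrow> 'm \<Rightarrow> bool" where
  "unital_assoc_algebra C A \<mu> \<nu> \<longleftrightarrow>
     A \<in> obj C \<and> \<mu> \<in> hom C (A \<boxtimes>\<^bsub>C\<^esub> A) A \<and> \<nu> \<in> hom C (tunit C) A \<and>
     \<mu> \<cdot>\<^bsub>C\<^esub> (\<mu> \<otimes>\<^bsub>C\<^esub> idn C A) = \<mu> \<cdot>\<^bsub>C\<^esub> (idn C A \<otimes>\<^bsub>C\<^esub> \<mu>) \<and>
     \<mu> \<cdot>\<^bsub>C\<^esub> (\<nu> \<otimes>\<^bsub>C\<^esub> idn C A) = idn C A \<and>
     \<mu> \<cdot>\<^bsub>C\<^esub> (idn C A \<otimes>\<^bsub>C\<^esub> \<nu>) = idn C A"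

definition normalized_pair ::
  "('o, 'm, 'z) moncat_scheme \<Rightarrow> 'o \<Rightarrow> 'm \<Rightarrow> 'm \<Rightarrow> bool" where
  "normalized_pair C A \<nu> \<epsilon> \<longleftrightarrow>
     \<nu> \<in> hom C (tunit C) A \<and> \<epsilon> \<in> hom C A (tunit C) \<and> \<epsilon> \<cdot>\<^bsub>C\<^esub> \<nu> = idn C (tunit C)"

text \<open>By strictness \<open>\<nu> \<otimes> \<mu>\<close> is an endomorphism of \<open>A \<boxtimes> A\<close>.\<close>

definition sigma_Ass :: "('o, 'm, 'z) moncat_scheme \<Rightarrow> 'm \<Rightarrow> 'm \<Rightarrow> 'm" where
  "sigma_Ass C \<mu> \<nu> = \<nu> \<otimes>\<^bsub>C\<^esub> \<mu>"

text \<open>Families are indexed by \<open>{1..r}\<close>; \<open>\<sigma> i j\<close> is only constrained for \<open>i \<le> j\<close>.\<close>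

definition braided_system ::
  "('o, 'm, 'z) moncat_scheme \<Rightarrow> nat \<Rightarrow> (nat \<Rightarrow> 'o) \<Rightarrow> (nat \<Rightarrow> nat \<Rightarrow> 'm) \<Rightarrow> bool" where
  "braided_system C r V \<sigma> \<longleftrightarrow>
     (\<forall>i \<in> {1..r}. V i \<in> obj C) \<and>
     (\<forall>i \<in> {1..r}. \<forall>j \<in> {1..r}. i \<le> j \<longrightarrow>
        \<sigma> i j \<in> hom C (V i \<boxtimes>\<^bsub>C\<^esub> V j) (V j \<boxtimes>\<^bsub>C\<^esub> V i)) \<and>
     (\<forall>i \<in> {1..r}. \<forall>j \<in> {1..r}. \<forall>k \<in> {1..r}. i \<le> j \<and> j \<le> k \<longrightarrow>
        (\<sigma> j k \<otimes>\<^bsub>C\<^esub> idn C (V i)) \<cdot>\<^bsub>C\<^esub> (idn C (V j) \<otimes>\<^bsub>C\<^esub> \<sigma> i k) \<cdot>\<^bsub>C\<^esub> (\<sigma> i j \<otimes>\<^bsub>C\<^esub> idn C (V k)) =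
        (idn C (V k) \<otimes>\<^bsub>C\<^esub> \<sigma> i j) \<cdot>\<^bsub>C\<^esub> (\<sigma> i k \<otimes>\<^bsub>C\<^esub> idn C (V j)) \<cdot>\<^bsub>C\<^esub> (idn C (V i) \<otimes>\<^bsub>C\<^esub> \<sigma> j k))"

definition pointed_braided_system ::
  "('o, 'm, 'z) moncat_scheme \<Rightarrow> nat \<Rightarrow> (nat \<Rightarrow> 'o) \<Rightarrow> (nat \<Rightarrow> nat \<Rightarrow> 'm) \<Rightarrow> (nat \<Rightarrow> 'm) \<Rightarrow> bool" where
  "pointed_braided_system C r V \<sigma> \<nu> \<longleftrightarrow>
     braided_system C r V \<sigma> \<and> (\<forall>i \<in> {1..r}. \<nu> i \<in> hom C (tunit C) (V i))"


section \<open>Categories of right modules\<close>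

text \<open>A module over a system is a pair \<open>(M, \<rho>)\<close>; the family \<open>\<rho>\<close> is required to be
  \<open>undefined\<close> outside \<open>{1..r}\<close>, so that it carries no more data than \<open>\<rho> 1, \<dots>, \<rho> r\<close>.\<close>

definition system_module ::
  "('o, 'm, 'z) moncat_scheme \<Rightarrow> nat \<Rightarrow> (nat \<Rightarrow> 'o) \<Rightarrow> (nat \<Rightarrow> nat \<Rightarrow> 'm) \<Rightarrow> (nat \<Rightarrow> 'm) \<Rightarrow>
     'o \<times> (nat \<Rightarrow> 'm) \<Rightarrow> bool" where
  "system_module C r V \<sigma> \<nu> = (\<lambda>(M, \<rho>).
     M \<in> obj C \<and> \<rho> \<in> extensional {1..r} \<and>
     (\<forall>i \<in> {1..r}. \<rho> i \<in> hom C (M \<boxtimes>\<^bsub>C\<^esub> V i) M) \<and>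
     (\<forall>i \<in> {1..r}. \<forall>j \<in> {1..r}. i \<le> j \<longrightarrow>
        \<rho> j \<cdot>\<^bsub>C\<^esub> (\<rho> i \<otimes>\<^bsub>C\<^esub> idn C (V j)) =
        \<rho> i \<cdot>\<^bsub>C\<^esub> (\<rho> j \<otimes>\<^bsub>C\<^esub> idn C (V i)) \<cdot>\<^bsub>C\<^esub> (idn C M \<otimes>\<^bsub>C\<^esub> \<sigma> i j)) \<and>
     (\<forall>i \<in> {1..r}. \<rho> i \<cdot>\<^bsub>C\<^esub> (idn C M \<otimes>\<^bsub>C\<^esub> \<nu> i) = idn C M))"

text \<open>A morphism of modules is stored as \<open>(X, f, Y)\<close>, with its source and target modules, since
  the same underlying morphism \<open>f\<close> may relate several pairs of modules.\<close>

definition system_module_cat ::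
  "('o, 'm, 'z) moncat_scheme \<Rightarrow> nat \<Rightarrow> (nat \<Rightarrow> 'o) \<Rightarrow> (nat \<Rightarrow> nat \<Rightarrow> 'm) \<Rightarrow> (nat \<Rightarrow> 'm) \<Rightarrow>
     ('o \<times> (nat \<Rightarrow> 'm), ('o \<times> (nat \<Rightarrow> 'm)) \<times> 'm \<times> ('o \<times> (nat \<Rightarrow> 'm))) cat" where
  "system_module_cat C r V \<sigma> \<nu> =
    \<lparr> obj = {X. system_module C r V \<sigma> \<nu> X},
      arr = {(X, f, Y). system_module C r V \<sigma> \<nu> X \<and> system_module C r V \<sigma> \<nu> Y \<and>
               f \<in> hom C (fst X) (fst Y) \<and>
               (\<forall>i \<in> {1..r}. f \<cdot>\<^bsub>C\<^esub> snd X i = snd Y i \<cdot>\<^bsub>C\<^esub> (f \<otimes>\<^bsub>C\<^esub> idn C (V i)))},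
      src = (\<lambda>(X, f, Y). X),
      tgt = (\<lambda>(X, f, Y). Y),
      idn = (\<lambda>X. (X, idn C (fst X), X)),
      cmp = (\<lambda>(_, g, Z) (X, f, _). (X, g \<cdot>\<^bsub>C\<^esub> f, Z)) \<rparr>"

definition algebra_module ::
  "('o, 'm, 'z) moncat_scheme \<Rightarrow> 'o \<Rightarrow> 'm \<Rightarrow> 'm \<Rightarrow> 'o \<times> 'm \<Rightarrow> bool" where
  "algebra_module C A \<mu> \<nu> = (\<lambda>(M, \<rho>).
     M \<in> obj C \<and> \<rho> \<in> hom C (M \<boxtimes>\<^bsub>C\<^esub> A) M \<and>
     \<rho> \<cdot>\<^bsub>C\<^esub> (\<rho> \<otimes>\<^bsub>C\<^esub> idn C A) = \<rho> \<cdot>\<^bsub>C\<^esub> (idn C M \<otimes>\<^bsub>C\<^esub> \<mu>) \<and>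
     \<rho> \<cdot>\<^bsub>C\<^esub> (idn C M \<otimes>\<^bsub>C\<^esub> \<nu>) = idn C M)"

definition algebra_module_cat ::
  "('o, 'm, 'z) moncat_scheme \<Rightarrow> 'o \<Rightarrow> 'm \<Rightarrow> 'm \<Rightarrow>
     ('o \<times> 'm, ('o \<times> 'm) \<times> 'm \<times> ('o \<times> 'm)) cat" where
  "algebra_module_cat C A \<mu> \<nu> =
    \<lparr> obj = {X. algebra_module C A \<mu> \<nu> X},
      arr = {(X, f, Y). algebra_module C A \<mu> \<nu> X \<and> algebra_module C A \<mu> \<nu> Y \<and>
               f \<in> hom C (fst X) (fst Y) \<and>
               f \<cdot>\<^bsub>C\<^esub> snd X = snd Y \<cdot>\<^bsub>C\<^esub> (f \<otimes>\<^bsub>C\<^esub> idn C A)},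
      src = (\<lambda>(X, f, Y). X),
      tgt = (\<lambda>(X, f, Y). Y),
      idn = (\<lambda>X. (X, idn C (fst X), X)),
      cmp = (\<lambda>(_, g, Z) (X, f, _). (X, g \<cdot>\<^bsub>C\<^esub> f, Z)) \<rparr>"


section \<open>The braided tensor product\<close>

definition rindex :: "nat \<Rightarrow> nat list" where
  "rindex r = rev [1..<Suc r]"

definition braided_tensor_obj :: "('o, 'm, 'z) moncat_scheme \<Rightarrow> nat \<Rightarrow> (nat \<Rightarrow> 'o) \<Rightarrow> 'o" where
  "braided_tensor_obj C r V = tobjs C (map V (rindex r))"

definition braided_tensor_unit :: "('o, 'm, 'z) moncat_scheme \<Rightarrow> nat \<Rightarrow> (nat \<Rightarrow> 'm) \<Rightarrow> 'm" where
  "braided_tensor_unit C r \<nu> = tarrs C (map \<nu> (rindex r))"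

text \<open>The identities surrounding \<open>\<xi> i j\<close> in \<open>\<xi>\<^bsub>i,j\<^esub>\<^bsup>p\<^esup>\<close> depend on the ambient tensor product
  \<open>V\<^bsub>w\<^sub>1\<^esub> \<otimes> \<dots> \<otimes> V\<^bsub>w\<^sub>n\<^esub>\<close>, which is recorded by the word \<open>w\<close> of indices.  Positions \<open>p\<close> are counted
  from \<open>1\<close>, and \<open>i\<close>, \<open>j\<close> are meant to be the letters of \<open>w\<close> at positions \<open>p\<close>, \<open>p + 1\<close>.\<close>

definition xi_at ::
  "('o, 'm, 'z) moncat_scheme \<Rightarrow> (nat \<Rightarrow> 'o) \<Rightarrow> (nat \<Rightarrow> nat \<Rightarrow> 'm) \<Rightarrow> nat list \<Rightarrow>
     nat \<Rightarrow> nat \<Rightarrow> nat \<Rightarrow> 'm" where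
  "xi_at C V \<xi> w i j p =
     idn C (tobjs C (map V (take (p - 1) w))) \<otimes>\<^bsub>C\<^esub> \<xi> i j \<otimes>\<^bsub>C\<^esub>
     idn C (tobjs C (map V (drop (p + 1) w)))"

text \<open>Composite of a list of \<open>\<xi>\<^bsub>i,j\<^esub>\<^bsup>p\<^esup>\<close>'s, the head of the list being applied first.\<close>

fun xi_composite ::
  "('o, 'm, 'z) moncat_scheme \<Rightarrow> (nat \<Rightarrow> 'o) \<Rightarrow> (nat \<Rightarrow> nat \<Rightarrow> 'm) \<Rightarrow> nat list \<Rightarrow>
     (nat \<times> nat \<times> nat) list \<Rightarrow> 'm" where
  "xi_composite C V \<xi> w [] = idn C (tobjs C (map V w))"
| "xi_composite C V \<xi> w ((i, j, p) # steps) =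
     xi_composite C V \<xi> (take (p - 1) w @ [j, i] @ drop (p + 1) w) steps \<cdot>\<^bsub>C\<^esub> xi_at C V \<xi> w i j p"

text \<open>The factors of
  \<open>\<xi>\<^bsub>1,2\<^esub>\<^bsup>2r-2\<^esup> (\<xi>\<^bsub>2,3\<^esub>\<^bsup>2r-4\<^esup> \<xi>\<^bsub>1,3\<^esub>\<^bsup>2r-3\<^esup>) \<cdots> (\<xi>\<^bsub>r-1,r\<^esub>\<^bsup>2\<^esup> \<cdots> \<xi>\<^bsub>2,r\<^esub>\<^bsup>r-1\<^esup> \<xi>\<^bsub>1,r\<^esub>\<^bsup>r\<^esup>)\<close>
  read from right to left, that is in order of application; the factor \<open>\<xi>\<^bsub>i,j\<^esub>\<close> sits at position
  \<open>2r + 1 - i - j\<close>.\<close>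

definition shuffle_steps :: "nat \<Rightarrow> (nat \<times> nat \<times> nat) list" where
  "shuffle_steps r = [(i, j, 2 * r + 1 - i - j). j \<leftarrow> rev [2..<Suc r], i \<leftarrow> [1..<j]]"

definition braided_tensor_mult ::
  "('o, 'm, 'z) moncat_scheme \<Rightarrow> nat \<Rightarrow> (nat \<Rightarrow> 'o) \<Rightarrow> (nat \<Rightarrow> nat \<Rightarrow> 'm) \<Rightarrow> (nat \<Rightarrow> 'm) \<Rightarrow> 'm" where
  "braided_tensor_mult C r V \<xi> \<mu> =
     tarrs C (map \<mu> (rindex r)) \<cdot>\<^bsub>C\<^esub> xi_composite C V \<xi> (rindex r @ rindex r) (shuffle_steps r)"

end

theory Submission
  imports Defs
begin

text \<open>
  Write \<open>A\<^sub>n = V\<^sub>n \<otimes> \<dots> \<otimes> V\<^sub>1\<close>.  The shuffle in the definition of the multiplication of \<open>A\<^sub>n\<^sub>+\<^sub>1\<close>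
  begins by moving the second copy of \<open>V\<^sub>n\<^sub>+\<^sub>1\<close> to the left past \<open>A\<^sub>n\<close> and then performs the shuffle
  of \<open>A\<^sub>n \<otimes> A\<^sub>n\<close>.  Hence \<open>A\<^sub>n\<^sub>+\<^sub>1 = V\<^sub>n\<^sub>+\<^sub>1 \<otimes> A\<^sub>n\<close> is a twisted tensor product of two algebras, the
  twist \<open>A\<^sub>n \<otimes> V\<^sub>n\<^sub>+\<^sub>1 \<rightarrow> V\<^sub>n\<^sub>+\<^sub>1 \<otimes> A\<^sub>n\<close> being a composite of the \<open>\<xi>\<^sub>i\<^sub>,\<^sub>n\<^sub>+\<^sub>1\<close> (lemma \<open>A_mult_Suc\<close>), and
  everything follows by induction on \<open>n\<close> from the case of two factors.

  For two factors \<open>V\<close>, \<open>A\<close> with a twist \<open>c : A \<otimes> V \<rightarrow> V \<otimes> A\<close> that is natural with respect to the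
  units \<open>\<nu>\<close> of \<open>V\<close> and \<open>u\<close> of \<open>A\<close>, a module structure \<open>\<beta>\<close> over \<open>V \<otimes> A\<close> is the same as a \<open>V\<close>-action \<open>\<rho>\<close> and an \<open>A\<close>-action \<open>\<alpha>\<close> with \<open>\<rho>(\<alpha> \<otimes> Id) = \<alpha>(\<rho> \<otimes> Id)(Id \<otimes> c)\<close>.  One
  direction acts by \<open>V\<close> first and then by \<open>A\<close>: \<open>\<beta> = \<alpha>(\<rho> \<otimes> Id)\<close> (\<open>module_of_pair\<close>); the other
  restricts \<open>\<beta>\<close> along \<open>Id \<otimes> u : V \<rightarrow> V \<otimes> A\<close> and \<open>\<nu> \<otimes> Id : A \<rightarrow> V \<otimes> A\<close> (\<open>pair_of_module\<close>).  The
  second direction rests on the four products of these two inclusions in \<open>V \<otimes> A\<close>: each inclusion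
  is multiplicative, \<open>V\<close> times \<open>A\<close> is the identity of \<open>V \<otimes> A\<close>, and \<open>A\<close> times \<open>V\<close> is the twist \<open>c\<close>.

  The compatibility of a \<open>V\<^sub>j\<close>-action with an \<open>A\<^sub>n\<close>-action through the composite twist splits, again
  by induction on \<open>n\<close>, into compatibilities through the single \<open>\<xi>\<^sub>i\<^sub>,\<^sub>j\<close>, \<open>i \<le> n\<close> (\<open>entwined_act\<close>,
  \<open>entwined_inclusion\<close>): inserting units turns the composite twist back into its constituents.  For
  \<open>i = j\<close> the relation of a system module, with \<open>\<xi>\<^sub>i\<^sub>,\<^sub>i = \<nu>\<^sub>i \<otimes> \<mu>\<^sub>i\<close>, is associativity of the
  \<open>V\<^sub>i\<close>-action.

  Both constructions leave the underlying object and the underlying morphisms alone and are mutually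
  inverse, so that the two module categories are even isomorphic.
\<close>

section \<open>Calculating in a strict monoidal category\<close>

context strict_monoidal_category
begin

lemma arr_cmp: "\<lbrakk>f \<in> arr C; g \<in> arr C; tgt C f = src C g\<rbrakk> \<Longrightarrow> g \<cdot> f \<in> arr C"
  and src_cmp: "\<lbrakk>f \<in> arr C; g \<in> arr C; tgt C f = src C g\<rbrakk> \<Longrightarrow> src C (g \<cdot> f) = src C f"
  and tgt_cmp: "\<lbrakk>f \<in> arr C; g \<in> arr C; tgt C f = src C g\<rbrakk> \<Longrightarrow> tgt C (g \<cdot> f) = tgt C g"
  using cmp_hom[of f "src C f" "tgt C f" g "tgt C g"] by (auto simp: hom_def)

lemma arr_tarr: "\<lbrakk>f \<in> arr C; g \<in> arr C\<rbrakk> \<Longrightarrow> f \<otimes> g \<in> arr C"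
  and src_tarr: "\<lbrakk>f \<in> arr C; g \<in> arr C\<rbrakk> \<Longrightarrow> src C (f \<otimes> g) = src C f \<boxtimes> src C g"
  and tgt_tarr: "\<lbrakk>f \<in> arr C; g \<in> arr C\<rbrakk> \<Longrightarrow> tgt C (f \<otimes> g) = tgt C f \<boxtimes> tgt C g"
  using tarr_hom[of f "src C f" "tgt C f" g "src C g" "tgt C g"] by (auto simp: hom_def)

lemma arr_idn: "a \<in> obj C \<Longrightarrow> idn C a \<in> arr C"
  and src_idn: "a \<in> obj C \<Longrightarrow> src C (idn C a) = a"
  and tgt_idn: "a \<in> obj C \<Longrightarrow> tgt C (idn C a) = a"
  using idn_hom[of a] by (auto simp: hom_def)

lemma idn_cmp: "\<lbrakk>f \<in> arr C; tgt C f = b\<rbrakk> \<Longrightarrow> idn C b \<cdot> f = f"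
  and cmp_idn: "\<lbrakk>f \<in> arr C; src C f = a\<rbrakk> \<Longrightarrow> f \<cdot> idn C a = f"
  by (auto simp: hom_def intro: cmp_idn_left cmp_idn_right)

lemma assoc_cmp:
  "\<lbrakk>f \<in> arr C; g \<in> arr C; h \<in> arr C; tgt C f = src C g; tgt C g = src C h\<rbrakk>
    \<Longrightarrow> (h \<cdot> g) \<cdot> f = h \<cdot> (g \<cdot> f)"
  by (rule cmp_assoc) (auto simp: hom_def)

lemma interchange:
  "\<lbrakk>f \<in> arr C; f' \<in> arr C; g \<in> arr C; g' \<in> arr C; tgt C f = src C f'; tgt C g = src C g'\<rbrakk>
    \<Longrightarrow> (f' \<otimes> g') \<cdot> (f \<otimes> g) = (f' \<cdot> f) \<otimes> (g' \<cdot> g)"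
  by (rule tarr_cmp[symmetric]) (auto simp: hom_def)

text \<open>The side conditions are phrased with \<^const>\<open>arr\<close>, \<^const>\<open>src\<close>, \<^const>\<open>tgt\<close> instead of
  \<^const>\<open>hom\<close>: then no intermediate object has to be guessed, and the simplifier discharges
  them.\<close>
lemmas typing = arr_cmp src_cmp tgt_cmp arr_tarr src_tarr tgt_tarr arr_idn src_idn tgt_idn
  src_obj tgt_obj tunit_obj tobj_obj tobj_assoc tobj_unit_left tobj_unit_right

lemma interchange_assoc:
  "\<lbrakk>f \<in> arr C; f' \<in> arr C; g \<in> arr C; g' \<in> arr C; h \<in> arr C;
    tgt C f = src C f'; tgt C g = src C g'; tgt C h = src C f \<boxtimes> src C g\<rbrakk>
    \<Longrightarrow> (f' \<otimes> g') \<cdot> (f \<otimes> g) \<cdot> h = ((f' \<cdot> f) \<otimes> (g' \<cdot> g)) \<cdot> h"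
  by (simp add: assoc_cmp[symmetric] interchange typing)

text \<open>Strict associativity lets one factor on the left face two factors on the right; the
  simplifier cannot regroup a right-nested tensor product by itself.\<close>
lemma interchange_in2:
  assumes "f \<in> arr C" "f' \<in> arr C" "g \<in> arr C" "g' \<in> arr C" "h \<in> arr C"
    "src C f' = tgt C f \<boxtimes> tgt C g" "src C g' = tgt C h"
  shows "(f' \<otimes> g') \<cdot> (f \<otimes> g \<otimes> h) = (f' \<cdot> (f \<otimes> g)) \<otimes> (g' \<cdot> h)"
  using interchange[of "f \<otimes> g" f' h g'] assms by (simp add: typing tarr_assoc)

lemma idns_cmp:
  assumes "f \<in> arr C" "a \<in> obj C" "b \<in> obj C"
  shows "tgt C f = a \<boxtimes> b \<Longrightarrow> (idn C a \<otimes> idn C b) \<cdot> f = f"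
    and "src C f = a \<boxtimes> b \<Longrightarrow> f \<cdot> (idn C a \<otimes> idn C b) = f"
  using assms by (simp_all add: tarr_idn idn_cmp cmp_idn)

lemma idns_cmp3:
  assumes "f \<in> arr C" "a \<in> obj C" "b \<in> obj C" "c \<in> obj C"
  shows "tgt C f = a \<boxtimes> b \<boxtimes> c \<Longrightarrow> (idn C a \<otimes> idn C b \<otimes> idn C c) \<cdot> f = f"
    and "src C f = a \<boxtimes> b \<boxtimes> c \<Longrightarrow> f \<cdot> (idn C a \<otimes> idn C b \<otimes> idn C c) = f"
  using assms by (simp_all add: tarr_idn idn_cmp cmp_idn tobj_obj)

text \<open>Normal form: composites and tensor products nested to the right, identities split into
  identities of the factors.  The interchange law stays outside, because which tensor factors are
  to be merged differs from step to step.\<close>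
lemmas monoidal = typing assoc_cmp idn_cmp cmp_idn idns_cmp idns_cmp3 tarr_idn[symmetric] tarr_assoc
  tarr_unit_left tarr_unit_right

text \<open>A point \<open>p : I \<rightarrow> B\<close> slides past every morphism, the unit object being invisible.\<close>
lemma point_cmp:
  assumes "p \<in> arr C" "src C p = tunit C" "x \<in> arr C" "tgt C x = b"
  shows "(p \<otimes> idn C b) \<cdot> x = p \<otimes> x" "(idn C b \<otimes> p) \<cdot> x = x \<otimes> p"
  using interchange[of "idn C (tunit C)" p x "idn C b"] interchange[of x "idn C b" "idn C (tunit C)" p]
    assms by (auto simp: monoidal)

lemma split_left:
  assumes "f \<in> arr C" "g \<in> arr C" "h \<in> arr C" "src C f = tgt C g \<boxtimes> tgt C h"
  shows "f \<cdot> (g \<otimes> h) = (f \<cdot> (g \<otimes> idn C (tgt C h))) \<cdot> (idn C (src C g) \<otimes> h)"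
  using assms by (simp add: monoidal interchange)

lemma split_right:
  assumes "f \<in> arr C" "g \<in> arr C" "h \<in> arr C" "src C f = tgt C g \<boxtimes> tgt C h"
  shows "f \<cdot> (g \<otimes> h) = (f \<cdot> (idn C (tgt C g) \<otimes> h)) \<cdot> (g \<otimes> idn C (src C h))"
  using assms by (simp add: monoidal interchange)

end

section \<open>Twisted tensor product of two algebras\<close>

text \<open>The part of an algebra structure that the passage from \<open>A\<^sub>n\<close> to \<open>A\<^sub>n\<^sub>+\<^sub>1\<close> consumes and
  reproduces.\<close>
definition unital_mult :: "('o, 'm, 'z) moncat_scheme \<Rightarrow> 'o \<Rightarrow> 'm \<Rightarrow> 'm \<Rightarrow> bool" where
  "unital_mult C A m u \<longleftrightarrow>
     A \<in> obj C \<and> m \<in> hom C (A \<boxtimes>\<^bsub>C\<^esub> A) A \<and> u \<in> hom C (tunit C) A \<and>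
     m \<cdot>\<^bsub>C\<^esub> (u \<otimes>\<^bsub>C\<^esub> idn C A) = idn C A \<and> m \<cdot>\<^bsub>C\<^esub> (idn C A \<otimes>\<^bsub>C\<^esub> u) = idn C A"

definition twisted_mult ::
  "('o, 'm, 'z) moncat_scheme \<Rightarrow> 'o \<Rightarrow> 'o \<Rightarrow> 'm \<Rightarrow> 'm \<Rightarrow> 'm \<Rightarrow> 'm" where
  "twisted_mult C V A \<mu> m c =
     (\<mu> \<otimes>\<^bsub>C\<^esub> m) \<cdot>\<^bsub>C\<^esub> (idn C V \<otimes>\<^bsub>C\<^esub> c \<otimes>\<^bsub>C\<^esub> idn C A)"

text \<open>Acting by \<open>A\<close> and then by \<open>V\<close> is the same as first exchanging the two by \<open>c\<close> and then acting
  by \<open>V\<close> and then by \<open>A\<close>.  With \<open>c = \<xi>\<^sub>i\<^sub>,\<^sub>j\<close>, \<open>V = V\<^sub>j\<close>, \<open>A = V\<^sub>i\<close> this is the relation between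
  \<open>\<rho>\<^sub>i\<close> and \<open>\<rho>\<^sub>j\<close> in a module over a braided system.\<close>
definition entwined ::
  "('o, 'm, 'z) moncat_scheme \<Rightarrow> 'o \<Rightarrow> 'o \<Rightarrow> 'o \<Rightarrow> 'm \<Rightarrow> 'm \<Rightarrow> 'm \<Rightarrow> bool" where
  "entwined C M V A c \<rho> \<alpha> \<longleftrightarrow>
     \<rho> \<cdot>\<^bsub>C\<^esub> (\<alpha> \<otimes>\<^bsub>C\<^esub> idn C V) = \<alpha> \<cdot>\<^bsub>C\<^esub> (\<rho> \<otimes>\<^bsub>C\<^esub> idn C A) \<cdot>\<^bsub>C\<^esub> (idn C M \<otimes>\<^bsub>C\<^esub> c)"

locale twisted_pair = strict_monoidal_category C
  for C :: "('o, 'm, 'z) moncat_scheme" (structure) +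
  fixes V A :: 'o and \<mu> \<nu> m u c :: 'm
  assumes V_unital: "unital_mult C V \<mu> \<nu>"
    and A_unital: "unital_mult C A m u"
    and c_hom: "c \<in> hom C (A \<boxtimes> V) (V \<boxtimes> A)"
    and c_unit_left: "c \<cdot> (u \<otimes> idn C V) = idn C V \<otimes> u"
    and c_unit_right: "c \<cdot> (idn C A \<otimes> \<nu>) = \<nu> \<otimes> idn C A"
begin

abbreviation mult :: 'm where
  "mult \<equiv> twisted_mult C V A \<mu> m c"

lemma data: "V \<in> obj C" "A \<in> obj C"
  "\<mu> \<in> arr C" "src C \<mu> = V \<boxtimes> V" "tgt C \<mu> = V"
  "\<nu> \<in> arr C" "src C \<nu> = tunit C" "tgt C \<nu> = V"
  "m \<in> arr C" "src C m = A \<boxtimes> A" "tgt C m = A"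
  "u \<in> arr C" "src C u = tunit C" "tgt C u = A"
  "c \<in> arr C" "src C c = A \<boxtimes> V" "tgt C c = V \<boxtimes> A"
  using V_unital A_unital c_hom by (auto simp: unital_mult_def hom_def)

lemma units: "\<mu> \<cdot> (\<nu> \<otimes> idn C V) = idn C V" "\<mu> \<cdot> (idn C V \<otimes> \<nu>) = idn C V"
  "m \<cdot> (u \<otimes> idn C A) = idn C A" "m \<cdot> (idn C A \<otimes> u) = idn C A"
  using V_unital A_unital by (auto simp: unital_mult_def)

lemma mult_hom: "mult \<in> hom C ((V \<boxtimes> A) \<boxtimes> (V \<boxtimes> A)) (V \<boxtimes> A)"
  unfolding twisted_mult_def by (simp add: hom_def data monoidal)

text \<open>Only the two inner factors meet the twist; with a unit among them, \<open>c_unit\<close> removes it.  All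
  products below are computed in this way.\<close>
lemma mult_tensor:
  assumes "a \<in> arr C" "tgt C a = V" "b \<in> arr C" "tgt C b = A"
    and "a' \<in> arr C" "tgt C a' = V" "b' \<in> arr C" "tgt C b' = A"
  shows "mult \<cdot> ((a \<otimes> b) \<otimes> (a' \<otimes> b')) = (\<mu> \<otimes> m) \<cdot> (a \<otimes> (c \<cdot> (b \<otimes> a')) \<otimes> b')"
proof -
  have "(idn C V \<otimes> (c \<otimes> idn C A)) \<cdot> (a \<otimes> (b \<otimes> a' \<otimes> b')) =  a \<otimes> (c \<cdot> (b \<otimes> a')) \<otimes> b'"
    using assms by (simp add: data monoidal interchange interchange_in2)
  then show ?thesis
    using assms unfolding twisted_mult_def by (simp add: data monoidal)
qed

lemma mu_unit:
  assumes "x \<in> arr C" "tgt C x = V"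
  shows "\<mu> \<cdot> (\<nu> \<otimes> x) = x" "\<mu> \<cdot> (x \<otimes> \<nu>) = x"
  using split_left[of \<mu> \<nu> x] split_right[of \<mu> x \<nu>] assms by (simp_all add: data units monoidal)

lemma m_unit:
  assumes "x \<in> arr C" "tgt C x = A"
  shows "m \<cdot> (u \<otimes> x) = x" "m \<cdot> (x \<otimes> u) = x"
  using split_left[of m u x] split_right[of m x u] assms by (simp_all add: data units monoidal)

lemma c_unit:
  assumes "x \<in> arr C"
  shows "tgt C x = V \<Longrightarrow> c \<cdot> (u \<otimes> x) = x \<otimes> u" "tgt C x = A \<Longrightarrow> c \<cdot> (x \<otimes> \<nu>) = \<nu> \<otimes> x"
  using split_left[of c u x] split_right[of c x \<nu>] assms
  by (simp_all add: data monoidal point_cmp c_unit_left c_unit_right)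

lemma mult_VV: "mult \<cdot> ((idn C V \<otimes> u) \<otimes> (idn C V \<otimes> u)) = (idn C V \<otimes> u) \<cdot> \<mu>"
proof -
  have "(idn C V \<otimes> u) \<cdot> \<mu> = \<mu> \<otimes> u"
    by (simp add: data point_cmp)
  moreover have "mult \<cdot> ((idn C V \<otimes> u) \<otimes> (idn C V \<otimes> u)) = \<mu> \<otimes> u"
    using interchange_in2[of "idn C V" \<mu> "idn C V" m "u \<otimes> u"]
    by (subst mult_tensor) (simp_all add: data monoidal c_unit m_unit)
  ultimately show ?thesis by simp
qed

lemma mult_AA: "mult \<cdot> ((\<nu> \<otimes> idn C A) \<otimes> (\<nu> \<otimes> idn C A)) = (\<nu> \<otimes> idn C A) \<cdot> m"
proof -
  have "(\<nu> \<otimes> idn C A) \<cdot> m = \<nu> \<otimes> m"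
    by (simp add: data point_cmp)
  moreover have "mult \<cdot> ((\<nu> \<otimes> idn C A) \<otimes> (\<nu> \<otimes> idn C A)) = \<nu> \<otimes> m"
    using interchange_in2[of \<nu> \<mu> \<nu> m "idn C A \<otimes> idn C A"]
    by (subst mult_tensor) (simp_all add: data monoidal c_unit mu_unit)
  ultimately show ?thesis by simp
qed

lemma mult_VA: "mult \<cdot> ((idn C V \<otimes> u) \<otimes> (\<nu> \<otimes> idn C A)) = idn C (V \<boxtimes> A)"
  using interchange_in2[of "idn C V" \<mu> \<nu> m "u \<otimes> idn C A"]
  by (subst mult_tensor) (simp_all add: data monoidal c_unit mu_unit m_unit)

text \<open>This product is where the twist becomes visible inside the algebra \<open>V \<otimes> A\<close>.\<close>
lemma mult_AV: "mult \<cdot> ((\<nu> \<otimes> idn C A) \<otimes> (idn C V \<otimes> u)) = c"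
proof -
  have "(\<mu> \<otimes> m) \<cdot> (\<nu> \<otimes> c \<otimes> u) = (\<mu> \<otimes> m) \<cdot> (\<nu> \<otimes> idn C V \<otimes> idn C A \<otimes> u) \<cdot> c"
    using interchange[of "c" "idn C V \<otimes> idn C A" "idn C (tunit C)" u]
      interchange[of "idn C (tunit C)" \<nu> c "idn C V \<otimes> idn C A \<otimes> u"]
    by (simp add: data monoidal)
  also have "\<dots> = ((\<mu> \<otimes> m) \<cdot> (\<nu> \<otimes> idn C V \<otimes> idn C A \<otimes> u)) \<cdot> c"
    by (simp add: data monoidal)
  also have "(\<mu> \<otimes> m) \<cdot> (\<nu> \<otimes> idn C V \<otimes> idn C A \<otimes> u) = idn C V \<otimes> idn C A"
    using interchange_in2[of \<nu> \<mu> "idn C V" m "idn C A \<otimes> u"]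
    by (simp add: data monoidal mu_unit m_unit)
  finally show ?thesis
    by (subst mult_tensor) (simp_all add: data monoidal)
qed

lemma unital: "unital_mult C (V \<boxtimes> A) mult (\<nu> \<otimes> u)"
proof -
  have "mult \<cdot> ((\<nu> \<otimes> u) \<otimes> (idn C V \<otimes> idn C A)) = idn C V \<otimes> idn C A"
    using interchange_in2[of "\<nu>" \<mu> "idn C V" m "u \<otimes> idn C A"]
    by (subst mult_tensor) (simp_all add: data monoidal c_unit mu_unit m_unit)
  moreover have "mult \<cdot> ((idn C V \<otimes> idn C A) \<otimes> (\<nu> \<otimes> u)) = idn C V \<otimes> idn C A"
    using interchange_in2[of "idn C V" \<mu> \<nu> m "idn C A \<otimes> u"]
    by (subst mult_tensor) (simp_all add: data monoidal c_unit mu_unit m_unit)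
  ultimately show ?thesis
    using mult_hom by (simp add: unital_mult_def hom_def data monoidal)
qed

text \<open>In \<open>M \<otimes> V \<otimes> A \<otimes> V \<otimes> A\<close> the compatibility of \<open>\<rho>\<close> and \<open>\<alpha>\<close> exchanges the two inner letters,
  after which the two actions of \<open>V\<close> and the two actions of \<open>A\<close> are adjacent and combine to \<open>\<mu>\<close>
  and \<open>m\<close>.\<close>
lemma module_of_pair:
  assumes \<rho>: "algebra_module C V \<mu> \<nu> (M, \<rho>)" and \<alpha>: "algebra_module C A m u (M, \<alpha>)"
    and comm: "entwined C M V A c \<rho> \<alpha>"
  shows "algebra_module C (V \<boxtimes> A) mult (\<nu> \<otimes> u) (M, \<alpha> \<cdot> (\<rho> \<otimes> idn C A))"
proof -
  have M: "M \<in> obj C" "\<rho> \<in> arr C" "src C \<rho> = M \<boxtimes> V" "tgt C \<rho> = M"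
    "\<alpha> \<in> arr C" "src C \<alpha> = M \<boxtimes> A" "tgt C \<alpha> = M"
    and \<rho>\<rho>: "\<rho> \<cdot> (\<rho> \<otimes> idn C V) = \<rho> \<cdot> (idn C M \<otimes> \<mu>)" and \<rho>\<nu>: "\<rho> \<cdot> (idn C M \<otimes> \<nu>) = idn C M"
    and \<alpha>\<alpha>: "\<alpha> \<cdot> (\<alpha> \<otimes> idn C A) = \<alpha> \<cdot> (idn C M \<otimes> m)" and \<alpha>u: "\<alpha> \<cdot> (idn C M \<otimes> u) = idn C M"
    using \<rho> \<alpha> by (auto simp: algebra_module_def hom_def)
  define \<beta> where "\<beta> = \<alpha> \<cdot> (\<rho> \<otimes> idn C A)"
  have \<beta>: "\<beta> \<in> arr C" "src C \<beta> = M \<boxtimes> V \<boxtimes> A" "tgt C \<beta> = M"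
    unfolding \<beta>_def by (simp_all add: data M monoidal)
  \<comment> \<open>The half of the product that concerns the second factor from \<open>V\<close>: it passes \<open>A\<close> and is
    absorbed by the first one.\<close>
  define Y where "Y = (\<mu> \<otimes> idn C A) \<cdot> (idn C V \<otimes> c)"
  have Y: "Y \<in> arr C" "src C Y = V \<boxtimes> A \<boxtimes> V" "tgt C Y = V \<boxtimes> A"
    unfolding Y_def by (simp_all add: data monoidal)
  have mult_Y: "mult = (idn C V \<otimes> m) \<cdot> (Y \<otimes> idn C A)"
  proof -
    have "\<mu> \<otimes> m = (idn C V \<otimes> m) \<cdot> (\<mu> \<otimes> idn C A \<otimes> idn C A)"
      by (simp add: data monoidal interchange)
    moreover have "(\<mu> \<otimes> idn C A \<otimes> idn C A) \<cdot> (idn C V \<otimes> c \<otimes> idn C A) = Y \<otimes> idn C A"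
      using interchange[of "idn C V \<otimes> c" "\<mu> \<otimes> idn C A" "idn C A" "idn C A"]
      by (simp add: Y_def data monoidal)
    ultimately show ?thesis
      unfolding twisted_mult_def by (simp add: data monoidal Y)
  qed
  have "\<rho> \<cdot> (\<beta> \<otimes> idn C V) = (\<rho> \<cdot> (\<alpha> \<otimes> idn C V)) \<cdot> (\<rho> \<otimes> idn C A \<otimes> idn C V)"
    unfolding \<beta>_def
    using interchange[of "\<rho> \<otimes> idn C A" \<alpha> "idn C V" "idn C V"] by (simp add: data M monoidal)
  also have "\<dots> = \<alpha> \<cdot> (\<rho> \<otimes> idn C A) \<cdot> (idn C M \<otimes> c) \<cdot> (\<rho> \<otimes> idn C A \<otimes> idn C V)"
    unfolding comm[unfolded entwined_def] by (simp add: data M monoidal)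
  also have "(idn C M \<otimes> c) \<cdot> (\<rho> \<otimes> idn C A \<otimes> idn C V) = (\<rho> \<otimes> idn C V \<otimes> idn C A) \<cdot> (idn C M \<otimes> idn C V \<otimes> c)"
    using interchange[of \<rho> "idn C M" "idn C A \<otimes> idn C V" c]
      interchange[of "idn C M \<otimes> idn C V" \<rho> c "idn C V \<otimes> idn C A"]
    by (simp add: data M monoidal)
  also have "\<alpha> \<cdot> (\<rho> \<otimes> idn C A) \<cdot> (\<rho> \<otimes> idn C V \<otimes> idn C A) \<cdot> (idn C M \<otimes> idn C V \<otimes> c)
    = \<alpha> \<cdot> ((\<rho> \<cdot> (\<rho> \<otimes> idn C V)) \<otimes> idn C A) \<cdot> (idn C M \<otimes> idn C V \<otimes> c)"
    using interchange_assoc[of "\<rho> \<otimes> idn C V" \<rho> "idn C A" "idn C A" "idn C M \<otimes> idn C V \<otimes> c"]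
    by (simp add: data M monoidal)
  also have "\<dots> = \<beta> \<cdot> (idn C M \<otimes> Y)"
  proof -
    have "((\<rho> \<cdot> (idn C M \<otimes> \<mu>)) \<otimes> idn C A) \<cdot> (idn C M \<otimes> idn C V \<otimes> c)
      = (\<rho> \<otimes> idn C A) \<cdot> (idn C M \<otimes> \<mu> \<otimes> idn C A) \<cdot> (idn C M \<otimes> idn C V \<otimes> c)"
      using interchange_assoc[of "idn C M \<otimes> \<mu>" \<rho> "idn C A" "idn C A" "idn C M \<otimes> idn C V \<otimes> c"]
      by (simp add: data M monoidal)
    also have "(idn C M \<otimes> \<mu> \<otimes> idn C A) \<cdot> (idn C M \<otimes> idn C V \<otimes> c) = idn C M \<otimes> Y"
      using interchange[of "idn C M" "idn C M" "idn C V \<otimes> c" "\<mu> \<otimes> idn C A"]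
      by (simp add: Y_def data M monoidal)
    finally show ?thesis
      unfolding \<rho>\<rho> by (simp add: \<beta>_def data M Y monoidal)
  qed
  finally have \<rho>\<beta>: "\<rho> \<cdot> (\<beta> \<otimes> idn C V) = \<beta> \<cdot> (idn C M \<otimes> Y)" .
  have "\<beta> \<cdot> (\<beta> \<otimes> idn C (V \<boxtimes> A)) = \<alpha> \<cdot> ((\<rho> \<cdot> (\<beta> \<otimes> idn C V)) \<otimes> idn C A)"
    using interchange_in2[of \<beta> \<rho> "idn C V" "idn C A" "idn C A"] \<beta>(1,3)
    unfolding \<beta>_def by (simp add: data M monoidal)
  also have "\<dots> = (\<alpha> \<cdot> (\<alpha> \<otimes> idn C A)) \<cdot> (\<rho> \<otimes> idn C A \<otimes> idn C A) \<cdot> (idn C M \<otimes> Y \<otimes> idn C A)"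
    using interchange[of "(\<rho> \<otimes> idn C A) \<cdot> (idn C M \<otimes> Y)" \<alpha> "idn C A" "idn C A"]
      interchange[of "idn C M \<otimes> Y" "\<rho> \<otimes> idn C A" "idn C A" "idn C A"]
    unfolding \<rho>\<beta> unfolding \<beta>_def by (simp add: data M Y monoidal)
  also have "\<dots> = \<alpha> \<cdot> ((idn C M \<otimes> m) \<cdot> (\<rho> \<otimes> idn C A \<otimes> idn C A)) \<cdot> (idn C M \<otimes> Y \<otimes> idn C A)"
    unfolding \<alpha>\<alpha> by (simp add: data M Y monoidal)
  also have "(idn C M \<otimes> m) \<cdot> (\<rho> \<otimes> idn C A \<otimes> idn C A) = (\<rho> \<otimes> idn C A) \<cdot> (idn C M \<otimes> idn C V \<otimes> m)"
    using interchange[of "idn C M \<otimes> idn C V" \<rho> m "idn C A"]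
    by (simp add: data M monoidal interchange)
  also have "\<alpha> \<cdot> ((\<rho> \<otimes> idn C A) \<cdot> (idn C M \<otimes> idn C V \<otimes> m)) \<cdot> (idn C M \<otimes> Y \<otimes> idn C A)
    = \<beta> \<cdot> (idn C M \<otimes> mult)"
    using interchange[of "idn C M" "idn C M" "Y \<otimes> idn C A" "idn C V \<otimes> m"]
    unfolding mult_Y \<beta>_def by (simp add: data M Y monoidal)
  finally have assoc: "\<beta> \<cdot> (\<beta> \<otimes> idn C (V \<boxtimes> A)) = \<beta> \<cdot> (idn C M \<otimes> mult)" .
  have "\<beta> \<cdot> (idn C M \<otimes> \<nu> \<otimes> u) = \<alpha> \<cdot> ((\<rho> \<cdot> (idn C M \<otimes> \<nu>)) \<otimes> u)"
    using interchange_in2[of "idn C M" \<rho> \<nu> "idn C A" u]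
    unfolding \<beta>_def by (simp add: data M monoidal)
  also have "\<dots> = idn C M"
    unfolding \<rho>\<nu> by (rule \<alpha>u)
  finally have "\<beta> \<cdot> (idn C M \<otimes> \<nu> \<otimes> u) = idn C M" .
  with assoc \<beta> show ?thesis
    unfolding \<beta>_def[symmetric] algebra_module_def by (simp add: hom_def data M monoidal)
qed

text \<open>A unit in one factor switches off the action of that factor.\<close>
lemma restrict_pair:
  assumes \<rho>: "\<rho> \<in> hom C (M \<boxtimes> V) M" "\<rho> \<cdot> (idn C M \<otimes> \<nu>) = idn C M"
    and \<alpha>: "\<alpha> \<in> hom C (M \<boxtimes> A) M" "\<alpha> \<cdot> (idn C M \<otimes> u) = idn C M"
    and M: "M \<in> obj C"
  shows "(\<alpha> \<cdot> (\<rho> \<otimes> idn C A)) \<cdot> (idn C M \<otimes> idn C V \<otimes> u) = \<rho>"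
    and "(\<alpha> \<cdot> (\<rho> \<otimes> idn C A)) \<cdot> (idn C M \<otimes> \<nu> \<otimes> idn C A) = \<alpha>"
proof -
  note M = M \<rho>(1)[unfolded hom_def, simplified] \<alpha>(1)[unfolded hom_def, simplified]
  have "(\<rho> \<otimes> idn C A) \<cdot> (idn C M \<otimes> idn C V \<otimes> u) = (idn C M \<otimes> u) \<cdot> \<rho>"
    using interchange_in2[of "idn C M" \<rho> "idn C V" "idn C A" u] by (simp add: data M monoidal point_cmp)
  then have "(\<alpha> \<cdot> (\<rho> \<otimes> idn C A)) \<cdot> (idn C M \<otimes> idn C V \<otimes> u) = (\<alpha> \<cdot> (idn C M \<otimes> u)) \<cdot> \<rho>"
    by (simp add: data M monoidal)
  also have "\<dots> = \<rho>"
    unfolding \<alpha>(2) by (simp add: data M monoidal)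
  finally show "(\<alpha> \<cdot> (\<rho> \<otimes> idn C A)) \<cdot> (idn C M \<otimes> idn C V \<otimes> u) = \<rho>" .
  have "(\<rho> \<otimes> idn C A) \<cdot> (idn C M \<otimes> \<nu> \<otimes> idn C A) = idn C M \<otimes> idn C A"
    using interchange_in2[of "idn C M" \<rho> \<nu> "idn C A" "idn C A"] by (simp add: data M monoidal \<rho>(2))
  then show "(\<alpha> \<cdot> (\<rho> \<otimes> idn C A)) \<cdot> (idn C M \<otimes> \<nu> \<otimes> idn C A) = \<alpha>"
    by (simp add: data M monoidal)
qed

text \<open>By associativity of \<open>\<beta>\<close>, acting along \<open>x\<close> and then along \<open>y\<close> is acting along their product
  in \<open>V \<otimes> A\<close>, for any \<open>x\<close>, \<open>y\<close> with values in \<open>V \<otimes> A\<close>.  The four claims are the four choices of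
  \<open>x\<close> and \<open>y\<close> among the inclusions of \<open>V\<close> and \<open>A\<close>.\<close>
lemma pair_of_module:
  assumes \<beta>: "algebra_module C (V \<boxtimes> A) mult (\<nu> \<otimes> u) (M, \<beta>)"
  defines "\<rho> \<equiv> \<beta> \<cdot> (idn C M \<otimes> idn C V \<otimes> u)" and "\<alpha> \<equiv> \<beta> \<cdot> (idn C M \<otimes> \<nu> \<otimes> idn C A)"
  shows "algebra_module C V \<mu> \<nu> (M, \<rho>)" (is ?V) and "algebra_module C A m u (M, \<alpha>)" (is ?A)
    and "\<alpha> \<cdot> (\<rho> \<otimes> idn C A) = \<beta>" (is ?VA)
    and "entwined C M V A c \<rho> \<alpha>" (is ?AV)
proof -
  have M: "M \<in> obj C" "\<beta> \<in> arr C" "src C \<beta> = M \<boxtimes> V \<boxtimes> A" "tgt C \<beta> = M"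
    and \<beta>\<beta>: "\<beta> \<cdot> (\<beta> \<otimes> idn C (V \<boxtimes> A)) = \<beta> \<cdot> (idn C M \<otimes> mult)"
    and \<beta>u: "\<beta> \<cdot> (idn C M \<otimes> \<nu> \<otimes> u) = idn C M"
    using \<beta> by (auto simp: algebra_module_def hom_def)
  have \<rho>: "\<rho> \<in> arr C" "src C \<rho> = M \<boxtimes> V" "tgt C \<rho> = M"
    unfolding \<rho>_def by (simp_all add: data M monoidal)
  have \<alpha>: "\<alpha> \<in> arr C" "src C \<alpha> = M \<boxtimes> A" "tgt C \<alpha> = M"
    unfolding \<alpha>_def by (simp_all add: data M monoidal)
  have mult: "mult \<in> arr C" "src C mult = V \<boxtimes> A \<boxtimes> V \<boxtimes> A" "tgt C mult = V \<boxtimes> A"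
    using mult_hom by (auto simp: hom_def data monoidal)
  have comp: "(\<beta> \<cdot> (idn C M \<otimes> y)) \<cdot> ((\<beta> \<cdot> (idn C M \<otimes> x)) \<otimes> idn C (src C y))
      = \<beta> \<cdot> (idn C M \<otimes> (mult \<cdot> (x \<otimes> y)))"
    if xy: "x \<in> arr C" "tgt C x = V \<boxtimes> A" "y \<in> arr C" "tgt C y = V \<boxtimes> A" for x y
  proof -
    have "(\<beta> \<cdot> (idn C M \<otimes> y)) \<cdot> ((\<beta> \<cdot> (idn C M \<otimes> x)) \<otimes> idn C (src C y))
      = \<beta> \<cdot> ((\<beta> \<cdot> (idn C M \<otimes> x)) \<otimes> y)"
      using interchange[of "\<beta> \<cdot> (idn C M \<otimes> x)" "idn C M" "idn C (src C y)" y]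
      by (simp add: data M monoidal xy)
    also have "(\<beta> \<cdot> (idn C M \<otimes> x)) \<otimes> y = (\<beta> \<otimes> idn C (V \<boxtimes> A)) \<cdot> (idn C M \<otimes> x \<otimes> y)"
      using interchange_in2[of "idn C M" \<beta> x "idn C (V \<boxtimes> A)" y]
      by (simp add: data M typing idn_cmp xy)
    also have "\<beta> \<cdot> (\<beta> \<otimes> idn C (V \<boxtimes> A)) \<cdot> (idn C M \<otimes> x \<otimes> y)
      = (\<beta> \<cdot> (\<beta> \<otimes> idn C (V \<boxtimes> A))) \<cdot> (idn C M \<otimes> x \<otimes> y)"
      by (simp add: data M typing assoc_cmp xy)
    also have "\<dots> = \<beta> \<cdot> (idn C M \<otimes> (mult \<cdot> (x \<otimes> y)))"
      unfolding \<beta>\<beta> using interchange[of "idn C M" "idn C M" "x \<otimes> y" mult]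
      by (simp add: data M monoidal xy mult)
    finally show ?thesis .
  qed
  have xy: "idn C V \<otimes> u \<in> arr C" "src C (idn C V \<otimes> u) = V" "tgt C (idn C V \<otimes> u) = V \<boxtimes> A"
    "\<nu> \<otimes> idn C A \<in> arr C" "src C (\<nu> \<otimes> idn C A) = A" "tgt C (\<nu> \<otimes> idn C A) = V \<boxtimes> A"
    by (simp_all add: data monoidal)
  show ?VA
    using comp[of "idn C V \<otimes> u" "\<nu> \<otimes> idn C A"] unfolding mult_VA xy \<rho>_def \<alpha>_def
    by (simp add: xy data M monoidal)
  then have VA: "(\<alpha> \<cdot> (\<rho> \<otimes> idn C A)) \<cdot> x = \<beta> \<cdot> x" for x by simp
  show ?AV
    using comp[of "\<nu> \<otimes> idn C A" "idn C V \<otimes> u"] VA[of "idn C M \<otimes> c"]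
    unfolding entwined_def mult_AV xy \<rho>_def[symmetric] \<alpha>_def[symmetric]
    by (simp add: xy data M monoidal \<rho> \<alpha>)
  have "\<rho> \<cdot> (\<rho> \<otimes> idn C V) = \<rho> \<cdot> (idn C M \<otimes> \<mu>)"
    using comp[of "idn C V \<otimes> u" "idn C V \<otimes> u"]
      interchange[of "idn C M" "idn C M" \<mu> "idn C V \<otimes> u"]
    unfolding mult_VV xy \<rho>_def
    by (simp add: xy data M monoidal)
  moreover have "\<rho> \<cdot> (idn C M \<otimes> \<nu>) = idn C M"
    using interchange[of "idn C M" "idn C M" \<nu> "idn C V \<otimes> u"] \<beta>u
    unfolding \<rho>_def by (simp add: data M monoidal point_cmp)
  ultimately show ?V
    unfolding algebra_module_def by (simp add: hom_def data M \<rho>)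
  have "\<alpha> \<cdot> (\<alpha> \<otimes> idn C A) = \<alpha> \<cdot> (idn C M \<otimes> m)"
    using comp[of "\<nu> \<otimes> idn C A" "\<nu> \<otimes> idn C A"]
      interchange[of "idn C M" "idn C M" m "\<nu> \<otimes> idn C A"]
    unfolding mult_AA xy \<alpha>_def
    by (simp add: xy data M monoidal)
  moreover have "\<alpha> \<cdot> (idn C M \<otimes> u) = idn C M"
    using interchange[of "idn C M" "idn C M" u "\<nu> \<otimes> idn C A"] \<beta>u
    unfolding \<alpha>_def by (simp add: data M monoidal point_cmp)
  ultimately show ?A
    unfolding algebra_module_def by (simp add: hom_def data M \<alpha>)
qed
end

section \<open>Twisting past a tensor product\<close>

text \<open>\<open>V\<close> passes to the left of \<open>W \<otimes> A\<close> by first passing \<open>A\<close> and then \<open>W\<close>.\<close>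
definition extend_twist ::
  "('o, 'm, 'z) moncat_scheme \<Rightarrow> 'o \<Rightarrow> 'o \<Rightarrow> 'm \<Rightarrow> 'm \<Rightarrow> 'm" where
  "extend_twist C W A \<xi> c = (\<xi> \<otimes>\<^bsub>C\<^esub> idn C A) \<cdot>\<^bsub>C\<^esub> (idn C W \<otimes>\<^bsub>C\<^esub> c)"

locale twist_extension = strict_monoidal_category C
  for C :: "('o, 'm, 'z) moncat_scheme" (structure) +
  fixes W A V :: 'o and \<omega> u \<nu> \<xi> c :: 'm
  assumes objs: "W \<in> obj C" "A \<in> obj C" "V \<in> obj C"
    and point_homs: "\<omega> \<in> hom C (tunit C) W" "u \<in> hom C (tunit C) A" "\<nu> \<in> hom C (tunit C) V"
    and \<xi>_hom: "\<xi> \<in> hom C (W \<boxtimes> V) (V \<boxtimes> W)"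
    and \<xi>_unit_left: "\<xi> \<cdot> (\<omega> \<otimes> idn C V) = idn C V \<otimes> \<omega>"
    and \<xi>_unit_right: "\<xi> \<cdot> (idn C W \<otimes> \<nu>) = \<nu> \<otimes> idn C W"
    and c_hom: "c \<in> hom C (A \<boxtimes> V) (V \<boxtimes> A)"
    and c_unit_left: "c \<cdot> (u \<otimes> idn C V) = idn C V \<otimes> u"
    and c_unit_right: "c \<cdot> (idn C A \<otimes> \<nu>) = \<nu> \<otimes> idn C A"
begin

abbreviation twist :: 'm where
  "twist \<equiv> extend_twist C W A \<xi> c"

lemma data:
  "\<omega> \<in> arr C" "src C \<omega> = tunit C" "tgt C \<omega> = W"
  "u \<in> arr C" "src C u = tunit C" "tgt C u = A"
  "\<nu> \<in> arr C" "src C \<nu> = tunit C" "tgt C \<nu> = V"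
  "\<xi> \<in> arr C" "src C \<xi> = W \<boxtimes> V" "tgt C \<xi> = V \<boxtimes> W"
  "c \<in> arr C" "src C c = A \<boxtimes> V" "tgt C c = V \<boxtimes> A"
  using point_homs \<xi>_hom c_hom by (auto simp: hom_def)

lemma twist_hom: "twist \<in> hom C ((W \<boxtimes> A) \<boxtimes> V) (V \<boxtimes> (W \<boxtimes> A))"
  unfolding extend_twist_def by (simp add: hom_def data objs monoidal)

lemma twist_tensor:
  assumes "a \<in> arr C" "tgt C a = W" "b \<in> arr C" "tgt C b = A" "x \<in> arr C" "tgt C x = V"
  shows "twist \<cdot> ((a \<otimes> b) \<otimes> x) = (\<xi> \<otimes> idn C A) \<cdot> (a \<otimes> (c \<cdot> (b \<otimes> x)))"
proof -
  have "(idn C W \<otimes> c) \<cdot> (a \<otimes> b \<otimes> x) = a \<otimes> (c \<cdot> (b \<otimes> x))"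
    using assms by (simp add: data objs monoidal interchange)
  then show ?thesis
    using assms unfolding extend_twist_def by (simp add: data objs monoidal)
qed

text \<open>A unit in one of the factors \<open>W\<close>, \<open>A\<close> is passed for free, so only the twist past the other
  factor remains.\<close>
lemma twist_restrict_W: "twist \<cdot> ((idn C W \<otimes> u) \<otimes> idn C V) = \<xi> \<otimes> u"
  using interchange_in2[of "idn C W" \<xi> "idn C V" "idn C A" u]
  by (subst twist_tensor) (simp_all add: data objs monoidal c_unit_left)

lemma twist_restrict_A: "twist \<cdot> ((\<omega> \<otimes> idn C A) \<otimes> idn C V) = (idn C V \<otimes> \<omega> \<otimes> idn C A) \<cdot> c"
proof -
  have "(\<xi> \<otimes> idn C A) \<cdot> (\<omega> \<otimes> c) = (\<xi> \<otimes> idn C A) \<cdot> (\<omega> \<otimes> idn C V \<otimes> idn C A) \<cdot> c"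
    using interchange[of "idn C (tunit C)" \<omega> c "idn C V \<otimes> idn C A"]
    by (simp add: data objs monoidal)
  also have "\<dots> = ((\<xi> \<otimes> idn C A) \<cdot> (\<omega> \<otimes> idn C V \<otimes> idn C A)) \<cdot> c"
    by (simp add: data objs monoidal)
  also have "(\<xi> \<otimes> idn C A) \<cdot> (\<omega> \<otimes> idn C V \<otimes> idn C A) = idn C V \<otimes> \<omega> \<otimes> idn C A"
    using interchange_in2[of \<omega> \<xi> "idn C V" "idn C A" "idn C A"]
    by (simp add: data objs monoidal \<xi>_unit_left)
  finally show ?thesis
    by (subst twist_tensor) (simp_all add: data objs monoidal)
qed

lemma twist_unit_left: "twist \<cdot> ((\<omega> \<otimes> u) \<otimes> idn C V) = idn C V \<otimes> (\<omega> \<otimes> u)"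
  using interchange_in2[of \<omega> \<xi> "idn C V" "idn C A" u]
  by (subst twist_tensor) (simp_all add: data objs monoidal c_unit_left \<xi>_unit_left)

lemma twist_unit_right: "twist \<cdot> (idn C (W \<boxtimes> A) \<otimes> \<nu>) = \<nu> \<otimes> idn C (W \<boxtimes> A)"
proof -
  have "twist \<cdot> ((idn C W \<otimes> idn C A) \<otimes> \<nu>) = \<nu> \<otimes> idn C W \<otimes> idn C A"
    using interchange_in2[of "idn C W" \<xi> \<nu> "idn C A" "idn C A"]
    by (subst twist_tensor) (simp_all add: data objs monoidal c_unit_right \<xi>_unit_right)
  then show ?thesis by (simp add: objs tarr_idn)
qed

text \<open>The letter \<open>V\<close> is moved past the two actions making up the action of \<open>W \<otimes> A\<close>, one at a
  time.\<close>
lemma entwined_twist: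
  assumes M: "M \<in> obj C" and \<rho>: "\<rho> \<in> hom C (M \<boxtimes> V) M"
    and \<alpha>: "\<alpha> \<in> hom C (M \<boxtimes> A) M" and \<beta>: "\<beta> \<in> hom C (M \<boxtimes> W) M"
    and W: "entwined C M V W \<xi> \<rho> \<beta>" and A: "entwined C M V A c \<rho> \<alpha>"
  shows "entwined C M V (W \<boxtimes> A) twist \<rho> (\<alpha> \<cdot> (\<beta> \<otimes> idn C A))"
proof -
  note M = M \<rho>[unfolded hom_def, simplified] \<alpha>[unfolded hom_def, simplified]
    \<beta>[unfolded hom_def, simplified]
  have "\<rho> \<cdot> ((\<alpha> \<cdot> (\<beta> \<otimes> idn C A)) \<otimes> idn C V) = (\<rho> \<cdot> (\<alpha> \<otimes> idn C V)) \<cdot> (\<beta> \<otimes> idn C A \<otimes> idn C V)"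
    using interchange[of "\<beta> \<otimes> idn C A" \<alpha> "idn C V" "idn C V"] by (simp add: data objs M monoidal)
  also have "\<dots> = \<alpha> \<cdot> (\<rho> \<otimes> idn C A) \<cdot> (idn C M \<otimes> c) \<cdot> (\<beta> \<otimes> idn C A \<otimes> idn C V)"
    unfolding A[unfolded entwined_def] by (simp add: data objs M monoidal)
  also have "(idn C M \<otimes> c) \<cdot> (\<beta> \<otimes> idn C A \<otimes> idn C V) = (\<beta> \<otimes> idn C V \<otimes> idn C A) \<cdot> (idn C M \<otimes> idn C W \<otimes> c)"
    using interchange[of \<beta> "idn C M" "idn C A \<otimes> idn C V" c]
      interchange[of "idn C M \<otimes> idn C W" \<beta> c "idn C V \<otimes> idn C A"]
    by (simp add: data objs M monoidal)
  also have "(\<rho> \<otimes> idn C A) \<cdot> (\<beta> \<otimes> idn C V \<otimes> idn C A) \<cdot> (idn C M \<otimes> idn C W \<otimes> c)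
    = ((\<rho> \<cdot> (\<beta> \<otimes> idn C V)) \<otimes> idn C A) \<cdot> (idn C M \<otimes> idn C W \<otimes> c)"
    using interchange_assoc[of "\<beta> \<otimes> idn C V" \<rho> "idn C A" "idn C A" "idn C M \<otimes> idn C W \<otimes> c"]
    by (simp add: data objs M monoidal)
  also have "(\<rho> \<cdot> (\<beta> \<otimes> idn C V)) \<otimes> idn C A
    = (\<beta> \<otimes> idn C A) \<cdot> (\<rho> \<otimes> idn C W \<otimes> idn C A) \<cdot> (idn C M \<otimes> \<xi> \<otimes> idn C A)"
    unfolding W[unfolded entwined_def]
    using interchange[of "(\<rho> \<otimes> idn C W) \<cdot> (idn C M \<otimes> \<xi>)" \<beta> "idn C A" "idn C A"]
      interchange[of "idn C M \<otimes> \<xi>" "\<rho> \<otimes> idn C W" "idn C A" "idn C A"]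
    by (simp add: data objs M monoidal)
  also have "\<alpha> \<cdot> ((\<beta> \<otimes> idn C A) \<cdot> (\<rho> \<otimes> idn C W \<otimes> idn C A) \<cdot> (idn C M \<otimes> \<xi> \<otimes> idn C A))
      \<cdot> (idn C M \<otimes> idn C W \<otimes> c)
    = (\<alpha> \<cdot> (\<beta> \<otimes> idn C A)) \<cdot> (\<rho> \<otimes> idn C W \<otimes> idn C A) \<cdot> (idn C M \<otimes> twist)"
    using interchange[of "idn C M" "idn C M" "idn C W \<otimes> c" "\<xi> \<otimes> idn C A"]
    unfolding extend_twist_def by (simp add: data objs M monoidal)
  finally show ?thesis
    unfolding entwined_def by (simp add: data objs M monoidal)
qed

text \<open>Converse of the previous lemma.  Restricting the compatibility along \<open>W \<rightarrow> W \<otimes> A\<close> and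
  \<open>A \<rightarrow> W \<otimes> A\<close> reduces the twist to \<open>\<xi>\<close> and to \<open>c\<close>.\<close>
lemma entwined_restrict:
  assumes M: "M \<in> obj C" and \<rho>: "\<rho> \<in> hom C (M \<boxtimes> V) M" and \<gamma>: "\<gamma> \<in> hom C (M \<boxtimes> (W \<boxtimes> A)) M"
    and ent: "entwined C M V (W \<boxtimes> A) twist \<rho> \<gamma>"
  shows "entwined C M V W \<xi> \<rho> (\<gamma> \<cdot> (idn C M \<otimes> idn C W \<otimes> u))"
    and "entwined C M V A c \<rho> (\<gamma> \<cdot> (idn C M \<otimes> \<omega> \<otimes> idn C A))"
proof -
  note M = M \<rho>[unfolded hom_def, simplified] \<gamma>[unfolded hom_def, simplified]
  have twist: "twist \<in> arr C" "src C twist = W \<boxtimes> A \<boxtimes> V" "tgt C twist = V \<boxtimes> W \<boxtimes> A"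
    using twist_hom by (auto simp: hom_def data objs monoidal)
  \<comment> \<open>For any \<open>x\<close> with values in \<open>W \<otimes> A\<close>; both claims are instances.\<close>
  have main: "\<rho> \<cdot> ((\<gamma> \<cdot> (idn C M \<otimes> x)) \<otimes> idn C V)
      = \<gamma> \<cdot> (\<rho> \<otimes> idn C W \<otimes> idn C A) \<cdot> (idn C M \<otimes> (twist \<cdot> (x \<otimes> idn C V)))"
    if x: "x \<in> arr C" "tgt C x = W \<boxtimes> A" for x
  proof -
    have "\<rho> \<cdot> ((\<gamma> \<cdot> (idn C M \<otimes> x)) \<otimes> idn C V)
      = (\<rho> \<cdot> (\<gamma> \<otimes> idn C V)) \<cdot> (idn C M \<otimes> x \<otimes> idn C V)"
      using interchange[of "idn C M \<otimes> x" \<gamma> "idn C V" "idn C V"]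
      by (simp add: data objs M x monoidal)
    also have "\<dots> = \<gamma> \<cdot> (\<rho> \<otimes> idn C W \<otimes> idn C A) \<cdot> (idn C M \<otimes> twist) \<cdot> (idn C M \<otimes> x \<otimes> idn C V)"
      unfolding ent[unfolded entwined_def] by (simp add: data objs M x twist monoidal)
    also have "(idn C M \<otimes> twist) \<cdot> (idn C M \<otimes> x \<otimes> idn C V) = idn C M \<otimes> (twist \<cdot> (x \<otimes> idn C V))"
      by (simp add: data objs M x twist monoidal interchange)
    finally show ?thesis .
  qed
  have "(\<rho> \<otimes> idn C W \<otimes> idn C A) \<cdot> (idn C M \<otimes> \<xi> \<otimes> u)
      = (idn C M \<otimes> idn C W \<otimes> u) \<cdot> (\<rho> \<otimes> idn C W) \<cdot> (idn C M \<otimes> \<xi>)"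
    using interchange_in2[of "idn C M" "\<rho> \<otimes> idn C W" \<xi> "idn C A" u]
      point_cmp(2)[of u "(\<rho> \<otimes> idn C W) \<cdot> (idn C M \<otimes> \<xi>)" "M \<boxtimes> W"]
    by (simp add: data objs M monoidal)
  then show "entwined C M V W \<xi> \<rho> (\<gamma> \<cdot> (idn C M \<otimes> idn C W \<otimes> u))"
    using main[of "idn C W \<otimes> u"] unfolding entwined_def twist_restrict_W
    by (simp add: data objs M monoidal)
  have "(\<rho> \<otimes> idn C W \<otimes> idn C A) \<cdot> (idn C M \<otimes> ((idn C V \<otimes> \<omega> \<otimes> idn C A) \<cdot> c))
      = (\<rho> \<otimes> idn C W \<otimes> idn C A) \<cdot> (idn C M \<otimes> idn C V \<otimes> \<omega> \<otimes> idn C A) \<cdot> (idn C M \<otimes> c)"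
    by (simp add: data objs M monoidal interchange)
  also have "\<dots> = ((\<rho> \<otimes> idn C W \<otimes> idn C A) \<cdot> (idn C M \<otimes> idn C V \<otimes> \<omega> \<otimes> idn C A)) \<cdot> (idn C M \<otimes> c)"
    by (simp add: data objs M monoidal)
  also have "(\<rho> \<otimes> idn C W \<otimes> idn C A) \<cdot> (idn C M \<otimes> idn C V \<otimes> \<omega> \<otimes> idn C A)
      = (idn C M \<otimes> \<omega> \<otimes> idn C A) \<cdot> (\<rho> \<otimes> idn C A)"
    using interchange_in2[of "idn C M" \<rho> "idn C V" "idn C W \<otimes> idn C A" "\<omega> \<otimes> idn C A"]
      interchange[of \<rho> "idn C M" "idn C A" "\<omega> \<otimes> idn C A"]
    by (simp add: data objs M monoidal)
  finally show "entwined C M V A c \<rho> (\<gamma> \<cdot> (idn C M \<otimes> \<omega> \<otimes> idn C A))"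
    using main[of "\<omega> \<otimes> idn C A"] unfolding entwined_def twist_restrict_A
    by (simp add: data objs M monoidal)
qed

end

section \<open>The braided tensor product as an iterated twisted product\<close>

lemma rindex_0: "rindex 0 = []"
  and rindex_Suc: "rindex (Suc n) = Suc n # rindex n"
  and set_rindex: "set (rindex n) = {1..n}"
  by (auto simp: rindex_def)

text \<open>Steps carry absolute positions, hence move by the length of the word put to the left.\<close>
definition shift :: "nat \<Rightarrow> (nat \<times> nat \<times> nat) list \<Rightarrow> (nat \<times> nat \<times> nat) list" where
  "shift k s = map (\<lambda>(i, j, p). (i, j, k + p)) s"

text \<open>The letter \<open>j\<close> at the end of \<open>n \<dots> 1 j\<close> meets \<open>1\<close> first, at position \<open>n\<close>, and \<open>n\<close> last, at
  position \<open>1\<close>.\<close>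
definition pass_steps :: "nat \<Rightarrow> nat \<Rightarrow> (nat \<times> nat \<times> nat) list" where
  "pass_steps n j = map (\<lambda>i. (i, j, Suc n - i)) [1..<Suc n]"

lemma pass_steps_Suc: "pass_steps (Suc n) j = shift 1 (pass_steps n j) @ [(Suc n, j, 1)]"
  by (auto simp: pass_steps_def shift_def)

text \<open>The factors \<open>\<xi>\<^sub>i\<^sub>,\<^sub>n\<^sub>+\<^sub>1\<close> are applied first and move the second letter \<open>n + 1\<close> to position \<open>2\<close>.
  From then on two letters \<open>n + 1\<close> stand in front of the shuffle for \<open>n\<close>.\<close>
lemma shuffle_steps_Suc:
  "shuffle_steps (Suc n) = shift 1 (pass_steps n (Suc n)) @ shift 2 (shuffle_steps n)"
proof -
  have "[(i, Suc n, 2 * Suc n + 1 - i - Suc n). i \<leftarrow> [1..<Suc n]] = shift 1 (pass_steps n (Suc n))"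
    by (auto simp: pass_steps_def shift_def)
  moreover have "[(i, j, 2 * Suc n + 1 - i - j). j \<leftarrow> rev [2..<Suc n], i \<leftarrow> [1..<j]] = shift 2 (shuffle_steps n)"
    unfolding shuffle_steps_def shift_def map_concat map_map
    by (intro arg_cong[where f = concat] map_cong refl) auto
  moreover have "shuffle_steps (Suc n) = [(i, Suc n, 2 * Suc n + 1 - i - Suc n). i \<leftarrow> [1..<Suc n]]
    @ [(i, j, 2 * Suc n + 1 - i - j). j \<leftarrow> rev [2..<Suc n], i \<leftarrow> [1..<j]]"
    \<comment> \<open>For \<open>n = 0\<close> the letter \<open>1\<close> is missing from \<open>[2..<2]\<close>, but there is no \<open>i\<close> below it either.\<close>
    by (cases n) (simp_all add: shuffle_steps_def)
  ultimately show ?thesis by simp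
qed

text \<open>The word \<open>n n \<dots> 1 1\<close>, to which the multiplications \<open>\<mu>\<^sub>n \<otimes> \<dots> \<otimes> \<mu>\<^sub>1\<close> apply.\<close>
definition doubled :: "nat \<Rightarrow> nat list" where
  "doubled n = concat (map (\<lambda>i. [i, i]) (rindex n))"

locale twisted_algebras = strict_monoidal_category C
  for C :: "('o, 'm, 'z) moncat_scheme" (structure) +
  fixes r :: nat and V :: "nat \<Rightarrow> 'o" and \<mu> \<nu> :: "nat \<Rightarrow> 'm" and \<xi> :: "nat \<Rightarrow> nat \<Rightarrow> 'm"
  assumes algebra: "i \<in> {1..r} \<Longrightarrow> unital_assoc_algebra C (V i) (\<mu> i) (\<nu> i)"
    and \<xi>_hom: "\<lbrakk>1 \<le> i; i < j; j \<le> r\<rbrakk> \<Longrightarrow> \<xi> i j \<in> hom C (V i \<boxtimes> V j) (V j \<boxtimes> V i)"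
    and \<xi>_unit_left: "\<lbrakk>1 \<le> i; i < j; j \<le> r\<rbrakk> \<Longrightarrow> \<xi> i j \<cdot> (\<nu> i \<otimes> idn C (V j)) = idn C (V j) \<otimes> \<nu> i"
    and \<xi>_unit_right: "\<lbrakk>1 \<le> i; i < j; j \<le> r\<rbrakk> \<Longrightarrow> \<xi> i j \<cdot> (idn C (V i) \<otimes> \<nu> j) = \<nu> j \<otimes> idn C (V i)"
    and \<xi>_diagonal: "i \<in> {1..r} \<Longrightarrow> \<xi> i i = sigma_Ass C (\<mu> i) (\<nu> i)"
begin

definition word_obj :: "nat list \<Rightarrow> 'o" where
  "word_obj w = tobjs C (map V w)"

abbreviation A :: "nat \<Rightarrow> 'o" where
  "A n \<equiv> braided_tensor_obj C n V"

abbreviation A_mult :: "nat \<Rightarrow> 'm" where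
  "A_mult n \<equiv> braided_tensor_mult C n V \<xi> \<mu>"

abbreviation A_unit :: "nat \<Rightarrow> 'm" where
  "A_unit n \<equiv> braided_tensor_unit C n \<nu>"

text \<open>The twist that moves \<open>V\<^sub>j\<close> to the left past all of \<open>A\<^sub>n\<close>.\<close>
primrec pass :: "nat \<Rightarrow> nat \<Rightarrow> 'm" where
  "pass 0 j = idn C (V j)"
| "pass (Suc n) j = extend_twist C (V (Suc n)) (A n) (\<xi> (Suc n) j) (pass n j)"

lemma V_obj: "i \<in> {1..r} \<Longrightarrow> V i \<in> obj C"
  and \<nu>_hom: "i \<in> {1..r} \<Longrightarrow> \<nu> i \<in> hom C (tunit C) (V i)"
  and \<mu>_hom: "i \<in> {1..r} \<Longrightarrow> \<mu> i \<in> hom C (V i \<boxtimes> V i) (V i)"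
  and V_unital: "i \<in> {1..r} \<Longrightarrow> unital_mult C (V i) (\<mu> i) (\<nu> i)"
  using algebra[of i] by (simp_all add: unital_assoc_algebra_def unital_mult_def)

lemma A_obj_0: "A 0 = tunit C" and A_obj_Suc: "A (Suc n) = V (Suc n) \<boxtimes> A n"
  by (simp_all add: braided_tensor_obj_def tobjs_def rindex_0 rindex_Suc)

lemma A_unit_0: "A_unit 0 = idn C (tunit C)" and A_unit_Suc: "A_unit (Suc n) = \<nu> (Suc n) \<otimes> A_unit n"
  by (simp_all add: braided_tensor_unit_def tarrs_def rindex_0 rindex_Suc)

lemma word_obj: "set w \<subseteq> {1..r} \<Longrightarrow> word_obj w \<in> obj C"
  by (induction w) (auto simp: word_obj_def tobjs_def intro!: tunit_obj tobj_obj V_obj)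

lemma word_obj_simps: "word_obj [] = tunit C" "word_obj (i # w) = V i \<boxtimes> word_obj w"
  by (simp_all add: word_obj_def tobjs_def)

lemma word_obj_append:
  "\<lbrakk>set v \<subseteq> {1..r}; set w \<subseteq> {1..r}\<rbrakk> \<Longrightarrow> word_obj (v @ w) = word_obj v \<boxtimes> word_obj w"
  by (induction v) (use word_obj V_obj in \<open>simp_all add: word_obj_simps typing\<close>)

lemma word_obj_rindex: "word_obj (rindex n) = A n"
  by (simp add: word_obj_def braided_tensor_obj_def)

lemma A_obj: "n \<le> r \<Longrightarrow> A n \<in> obj C"
  using word_obj[of "rindex n"] by (simp add: word_obj_rindex set_rindex)

lemma A_unit_hom: "n \<le> r \<Longrightarrow> A_unit n \<in> hom C (tunit C) (A n)"
proof (induction n)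
  case 0
  then show ?case by (simp add: A_unit_0 A_obj_0 idn_hom tunit_obj)
next
  case (Suc n)
  then show ?case
    using tarr_hom[of "\<nu> (Suc n)" "tunit C" "V (Suc n)" "A_unit n" "tunit C" "A n"] \<nu>_hom[of "Suc n"]
    by (simp add: A_unit_Suc A_obj_Suc typing)
qed

text \<open>Naturality of the single \<open>\<xi>\<^sub>i\<^sub>,\<^sub>j\<close> with respect to the units is inherited by their
  composites.\<close>
lemma pass_natural:
  "\<lbrakk>n < j; j \<le> r\<rbrakk> \<Longrightarrow> pass n j \<in> hom C (A n \<boxtimes> V j) (V j \<boxtimes> A n)
    \<and> pass n j \<cdot> (A_unit n \<otimes> idn C (V j)) = idn C (V j) \<otimes> A_unit n
    \<and> pass n j \<cdot> (idn C (A n) \<otimes> \<nu> j) = \<nu> j \<otimes> idn C (A n)"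
proof (induction n)
  case 0
  then show ?case
    using V_obj[of j] \<nu>_hom[of j] by (simp add: A_obj_0 A_unit_0 hom_def monoidal)
next
  case (Suc n)
  then interpret twist_extension C "V (Suc n)" "A n" "V j" "\<nu> (Suc n)" "A_unit n" "\<nu> j"
    "\<xi> (Suc n) j" "pass n j"
    by unfold_locales
      (use Suc V_obj[of j] V_obj[of "Suc n"] \<nu>_hom[of j] \<nu>_hom[of "Suc n"] in
        \<open>auto simp: A_obj A_unit_hom \<xi>_hom \<xi>_unit_left \<xi>_unit_right\<close>)
  show ?case
    using twist_hom twist_unit_left twist_unit_right by (simp add: A_obj_Suc A_unit_Suc)
qed

lemma twist_extension:
  "\<lbrakk>Suc n < j; j \<le> r\<rbrakk> \<Longrightarrow> twist_extension C (V (Suc n)) (A n) (V j) (\<nu> (Suc n)) (A_unit n) (\<nu> j)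
    (\<xi> (Suc n) j) (pass n j)"
    by unfold_locales
      (use V_obj[of j] V_obj[of "Suc n"] \<nu>_hom[of j] \<nu>_hom[of "Suc n"] pass_natural[of n j] in
        \<open>auto simp: A_obj A_unit_hom \<xi>_hom \<xi>_unit_left \<xi>_unit_right\<close>)

text \<open>\<open>sorts v s w\<close>: the steps \<open>s\<close> carry the word \<open>v\<close> to \<open>w\<close>, and each step \<open>(i, j, p)\<close> really finds
  the letters \<open>i < j\<close> at positions \<open>p\<close>, \<open>p + 1\<close>.  Without this the composite of the steps need not be
  composable in the category.\<close>
inductive sorts :: "nat list \<Rightarrow> (nat \<times> nat \<times> nat) list \<Rightarrow> nat list \<Rightarrow> bool" where
  sorts_Nil: "set w \<subseteq> {1..r} \<Longrightarrow> sorts w [] w"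
| sorts_Cons: "\<lbrakk>sorts (x @ j # i # y) s w; i < j\<rbrakk>
    \<Longrightarrow> sorts (x @ i # j # y) ((i, j, Suc (length x)) # s) w"

lemma sorts_letters: "sorts v s w \<Longrightarrow> set v \<subseteq> {1..r} \<and> set w \<subseteq> {1..r}"
  by (induction rule: sorts.induct) auto

lemma xi_composite_Nil: "xi_composite C V \<xi> w [] = idn C (word_obj w)"
  by (simp add: word_obj_def)

lemma xi_composite_Cons:
  "xi_composite C V \<xi> (x @ i # j # y) ((i, j, Suc (length x)) # s) =
    xi_composite C V \<xi> (x @ j # i # y) s \<cdot> (idn C (word_obj x) \<otimes> \<xi> i j \<otimes> idn C (word_obj y))"
  by (simp add: xi_at_def word_obj_def)

lemma xi_step_hom:
  assumes "set x \<subseteq> {1..r}" "set y \<subseteq> {1..r}" "1 \<le> i" "i < j" "j \<le> r"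
  shows "idn C (word_obj x) \<otimes> \<xi> i j \<otimes> idn C (word_obj y)
    \<in> hom C (word_obj (x @ i # j # y)) (word_obj (x @ j # i # y))"
  using \<xi>_hom[of i j] V_obj[of i] V_obj[of j] assms
  by (auto simp: hom_def word_obj_append word_obj_simps word_obj typing)

lemma sorts_step_hom:
  assumes "sorts (x @ j # i # y) s w" "i < j"
  shows "idn C (word_obj x) \<otimes> \<xi> i j \<otimes> idn C (word_obj y)
    \<in> hom C (word_obj (x @ i # j # y)) (word_obj (x @ j # i # y))"
  using sorts_letters[OF assms(1)] assms(2) by (intro xi_step_hom) auto

lemma xi_composite_hom: "sorts v s w \<Longrightarrow> xi_composite C V \<xi> v s \<in> hom C (word_obj v) (word_obj w)"
proof (induction rule: sorts.induct)
  case (sorts_Nil w)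
  then show ?case by (simp add: xi_composite_Nil idn_hom word_obj del: xi_composite.simps)
next
  case (sorts_Cons x j i y s w)
  then have "idn C (word_obj x) \<otimes> \<xi> i j \<otimes> idn C (word_obj y)
    \<in> hom C (word_obj (x @ i # j # y)) (word_obj (x @ j # i # y))"
    by (intro sorts_step_hom)
  with sorts_Cons show ?case
    by (subst xi_composite_Cons) (auto intro: cmp_hom)
qed

lemma sorts_append:
  "\<lbrakk>sorts u s v; sorts v t w\<rbrakk> \<Longrightarrow> sorts u (s @ t) w
    \<and> xi_composite C V \<xi> u (s @ t) = xi_composite C V \<xi> v t \<cdot> xi_composite C V \<xi> u s"
proof (induction arbitrary: t rule: sorts.induct)
  case (sorts_Nil v)
  then show ?case
    using xi_composite_hom[of v t w] by (auto simp: xi_composite_Nil hom_def cmp_idn simp del: xi_composite.simps)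
next
  case (sorts_Cons x j i y s v)
  then have "idn C (word_obj x) \<otimes> \<xi> i j \<otimes> idn C (word_obj y)
    \<in> hom C (word_obj (x @ i # j # y)) (word_obj (x @ j # i # y))"
    by (intro sorts_step_hom)
  moreover have "sorts ((x @ i # j # y)) ((i, j, Suc (length x)) # s @ t) w"
    using sorts_Cons by (intro sorts.sorts_Cons) auto
  ultimately show ?case
    using sorts_Cons xi_composite_hom[of v t w] xi_composite_hom[of "x @ j # i # y" s v]
    by (simp add: xi_composite_Cons cmp_assoc del: xi_composite.simps)
qed

text \<open>Steps inside a larger word give the composite of these steps tensored with identities; this
  makes the recursion on step lists a recursion on morphisms.\<close>
lemma sorts_whisker:
  assumes "sorts v s w" "set x \<subseteq> {1..r}" "set y \<subseteq> {1..r}"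
  shows "sorts (x @ v @ y) (shift (length x) s) (x @ w @ y)
    \<and> xi_composite C V \<xi> (x @ v @ y) (shift (length x) s)
      = idn C (word_obj x) \<otimes> xi_composite C V \<xi> v s \<otimes> idn C (word_obj y)"
  using assms
proof (induction rule: sorts.induct)
  case (sorts_Nil w)
  then show ?case
    by (simp add: xi_composite_Nil shift_def word_obj word_obj_append tarr_idn tobj_obj
        sorts.sorts_Nil del: xi_composite.simps)
next
  case (sorts_Cons a j i b s w)
  let ?\<xi> = "idn C (word_obj a) \<otimes> \<xi> i j \<otimes> idn C (word_obj b)"
  have letters: "set a \<subseteq> {1..r}" "set b \<subseteq> {1..r}" "1 \<le> i" "j \<le> r"
    using sorts_letters[OF sorts_Cons(1)] by auto
  have step: "?\<xi> \<in> hom C (word_obj (a @ i # j # b)) (word_obj (a @ j # i # b))"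
    using letters sorts_Cons by (intro xi_step_hom) auto
  have "\<xi> i j \<in> arr C" using \<xi>_hom[of i j] letters sorts_Cons by (auto simp: hom_def)
  then have "idn C (word_obj (x @ a)) \<otimes> \<xi> i j \<otimes> idn C (word_obj (b @ y))
    = idn C (word_obj x) \<otimes> ?\<xi> \<otimes> idn C (word_obj y)"
    using letters sorts_Cons by (simp add: word_obj_append word_obj monoidal)
  moreover have "xi_composite C V \<xi> (x @ (a @ i # j # b) @ y) (shift (length x) ((i, j, Suc (length a)) # s))
    = xi_composite C V \<xi> (x @ (a @ j # i # b) @ y) (shift (length x) s)
      \<cdot> (idn C (word_obj (x @ a)) \<otimes> \<xi> i j \<otimes> idn C (word_obj (b @ y)))"
    using xi_composite_Cons[of "x @ a" i j "b @ y" "shift (length x) s"] sorts_Cons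
    by (simp add: shift_def)
  moreover have "idn C (word_obj x) \<otimes> (xi_composite C V \<xi> (a @ j # i # b) s \<cdot> ?\<xi>) \<otimes> idn C (word_obj y)
    = (idn C (word_obj x) \<otimes> xi_composite C V \<xi> (a @ j # i # b) s \<otimes> idn C (word_obj y))
       \<cdot> (idn C (word_obj x) \<otimes> ?\<xi> \<otimes> idn C (word_obj y))"
    using step xi_composite_hom[OF sorts_Cons(1)] sorts_Cons
    by (simp add: hom_def interchange typing idn_cmp word_obj)
  ultimately have "xi_composite C V \<xi> (x @ (a @ i # j # b) @ y) (shift (length x) ((i, j, Suc (length a)) # s))
    = idn C (word_obj x) \<otimes> xi_composite C V \<xi> (a @ i # j # b) ((i, j, Suc (length a)) # s) \<otimes> idn C (word_obj y)"
    using sorts_Cons by (simp add: xi_composite_Cons del: xi_composite.simps)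
  moreover have "sorts ((x @ a) @ i # j # (b @ y)) ((i, j, Suc (length (x @ a))) # shift (length x) s) (x @ w @ y)"
    by (rule sorts.sorts_Cons) (use sorts_Cons in auto)
  ultimately show ?case by (simp add: shift_def)
qed

lemma sorts_pass:
  "\<lbrakk>n < j; j \<le> r\<rbrakk> \<Longrightarrow> sorts (rindex n @ [j]) (pass_steps n j) (j # rindex n)
    \<and> xi_composite C V \<xi> (rindex n @ [j]) (pass_steps n j) = pass n j"
proof (induction n)
  case 0
  then show ?case
    using V_obj[of j]
    by (auto simp: xi_composite_Nil rindex_0 pass_steps_def word_obj_simps typing
        simp del: xi_composite.simps intro!: sorts_Nil)
next
  case (Suc n)
  let ?s = "shift 1 (pass_steps n j)" and ?w = "[Suc n, j] @ rindex n"
  have "sorts ([Suc n] @ (rindex n @ [j]) @ []) ?s ?w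
    \<and> xi_composite C V \<xi> ([Suc n] @ (rindex n @ [j]) @ []) ?s = idn C (V (Suc n)) \<otimes> pass n j"
    using sorts_whisker[of "rindex n @ [j]" "pass_steps n j" "j # rindex n" "[Suc n]" "[]"] Suc
      V_obj[of "Suc n"] pass_natural[of n j]
    by (simp add: word_obj_simps hom_def monoidal)
  moreover have "sorts ?w [(Suc n, j, 1)] (j # Suc n # rindex n)"
    using Suc.prems sorts_Cons[of "[]" j "Suc n" "rindex n" "[]" "j # Suc n # rindex n"]
      sorts_Nil[of "j # Suc n # rindex n"] by (simp add: set_rindex)
  moreover have "xi_composite C V \<xi> ?w [(Suc n, j, 1)] = \<xi> (Suc n) j \<otimes> idn C (A n)"
    using Suc.prems xi_composite_Cons[of "[]" "Suc n" j "rindex n" "[]"]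
      xi_step_hom[of "[]" "rindex n" "Suc n" j] \<xi>_hom[of "Suc n" j] A_obj[of n]
    by (auto simp: xi_composite_Nil hom_def word_obj_simps word_obj_rindex set_rindex monoidal
        simp del: xi_composite.simps)
  ultimately show ?case
    using sorts_append[of "rindex (Suc n) @ [j]" ?s ?w "[(Suc n, j, 1)]" "j # Suc n # rindex n"]
    unfolding pass_steps_Suc by (simp add: rindex_Suc extend_twist_def del: xi_composite.simps)
qed

lemma tarrs_\<mu>_hom: "n \<le> r \<Longrightarrow> tarrs C (map \<mu> (rindex n)) \<in> hom C (word_obj (doubled n)) (A n)"
proof (induction n)
  case 0
  then show ?case
    by (simp add: tarrs_def doubled_def rindex_0 word_obj_simps A_obj_0 idn_hom tunit_obj)
next
  case (Suc n)
  have "word_obj (doubled n) \<in> obj C"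
    by (rule word_obj) (use Suc.prems in \<open>auto simp: doubled_def set_rindex\<close>)
  then show ?case
    using Suc V_obj[of "Suc n"] \<mu>_hom[of "Suc n"]
    tarr_hom[of "\<mu> (Suc n)" "V (Suc n) \<boxtimes> V (Suc n)" "V (Suc n)" "tarrs C (map \<mu> (rindex n))" "word_obj (doubled n)" "A n"]
    by (auto simp: tarrs_def doubled_def rindex_Suc word_obj_simps A_obj_Suc tobj_assoc)
qed

lemma sorts_shuffle_Suc:
  assumes "Suc n \<le> r" "sorts (rindex n @ rindex n) (shuffle_steps n) (doubled n)"
  shows "sorts (rindex (Suc n) @ rindex (Suc n)) (shuffle_steps (Suc n)) (doubled (Suc n))
    \<and> xi_composite C V \<xi> (rindex (Suc n) @ rindex (Suc n)) (shuffle_steps (Suc n))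
      = (idn C (V (Suc n)) \<otimes> idn C (V (Suc n)) \<otimes> xi_composite C V \<xi> (rindex n @ rindex n) (shuffle_steps n))
        \<cdot> (idn C (V (Suc n)) \<otimes> pass n (Suc n) \<otimes> idn C (A n))"
proof -
  let ?w = "[Suc n, Suc n] @ (rindex n @ rindex n) @ []"
  have hom: "xi_composite C V \<xi> (rindex n @ rindex n) (shuffle_steps n) \<in> arr C"
    using xi_composite_hom[OF assms(2)] by (simp add: hom_def)
  have "sorts ([Suc n] @ (rindex n @ [Suc n]) @ rindex n) (shift 1 (pass_steps n (Suc n))) ?w
    \<and> xi_composite C V \<xi> ([Suc n] @ (rindex n @ [Suc n]) @ rindex n) (shift 1 (pass_steps n (Suc n)))
     = idn C (V (Suc n)) \<otimes> pass n (Suc n) \<otimes> idn C (A n)"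
    using sorts_whisker[of "rindex n @ [Suc n]" "pass_steps n (Suc n)" "Suc n # rindex n" "[Suc n]" "rindex n"]
      sorts_pass[of n "Suc n"] V_obj[of "Suc n"] assms(1)
    by (simp add: word_obj_simps set_rindex word_obj_rindex typing)
  moreover have "sorts ?w (shift 2 (shuffle_steps n)) (doubled (Suc n))
    \<and> xi_composite C V \<xi> ?w (shift 2 (shuffle_steps n))
     = idn C (V (Suc n)) \<otimes> idn C (V (Suc n)) \<otimes> xi_composite C V \<xi> (rindex n @ rindex n) (shuffle_steps n)"
    using sorts_whisker[OF assms(2), of "[Suc n, Suc n]" "[]"] V_obj[of "Suc n"] assms(1) hom
    by (simp add: word_obj_simps doubled_def rindex_Suc monoidal numeral_2_eq_2)
  ultimately show ?thesis
    using sorts_append[of "rindex (Suc n) @ rindex (Suc n)" "shift 1 (pass_steps n (Suc n))" ?w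
      "shift 2 (shuffle_steps n)" "doubled (Suc n)"]
    unfolding shuffle_steps_Suc by (simp add: rindex_Suc)
qed

lemma sorts_shuffle: "n \<le> r \<Longrightarrow> sorts (rindex n @ rindex n) (shuffle_steps n) (doubled n)"
proof (induction n)
  case 0
  show ?case
    by (auto simp: rindex_0 shuffle_steps_def doubled_def intro!: sorts_Nil)
next
  case (Suc n)
  then show ?case using sorts_shuffle_Suc[of n] by simp
qed

lemma A_mult_0: "A_mult 0 = idn C (tunit C)"
  using cmp_idn_left[OF idn_hom[OF tunit_obj]]
  by (simp add: xi_composite_Nil braided_tensor_mult_def rindex_0 tarrs_def shuffle_steps_def
      word_obj_simps del: xi_composite.simps)

text \<open>The interchange law absorbs the remaining shuffle, which takes place next to the two letters
  \<open>n + 1\<close>, into the multiplication of \<open>A\<^sub>n\<close>.\<close>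
lemma A_mult_Suc:
  assumes "Suc n \<le> r"
  shows "A_mult (Suc n) = twisted_mult C (V (Suc n)) (A n) (\<mu> (Suc n)) (A_mult n) (pass n (Suc n))"
proof -
  let ?V = "V (Suc n)" and ?X = "xi_composite C V \<xi> (rindex n @ rindex n) (shuffle_steps n)"
  have V: "?V \<in> obj C" "A n \<in> obj C"
    using assms V_obj A_obj by auto
  have w: "word_obj (rindex n @ rindex n) = A n \<boxtimes> A n"
    using assms by (simp add: word_obj_append set_rindex word_obj_rindex)
  have homs: "\<mu> (Suc n) \<in> hom C (?V \<boxtimes> ?V) ?V" "?X \<in> hom C (A n \<boxtimes> A n) (word_obj (doubled n))"
    "tarrs C (map \<mu> (rindex n)) \<in> hom C (word_obj (doubled n)) (A n)"
    "pass n (Suc n) \<in> hom C (A n \<boxtimes> ?V) (?V \<boxtimes> A n)"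
    using assms \<mu>_hom xi_composite_hom[OF sorts_shuffle[of n]] tarrs_\<mu>_hom pass_natural w by auto
  have "(\<mu> (Suc n) \<otimes> tarrs C (map \<mu> (rindex n))) \<cdot> (idn C ?V \<otimes> idn C ?V \<otimes> ?X)
    = \<mu> (Suc n) \<otimes> A_mult n"
    using interchange_in2[of "idn C ?V" "\<mu> (Suc n)" "idn C ?V" "tarrs C (map \<mu> (rindex n))" ?X] homs V
    by (simp add: hom_def monoidal braided_tensor_mult_def)
  then have eq: "\<mu> (Suc n) \<otimes> A_mult n
    = (\<mu> (Suc n) \<otimes> tarrs C (map \<mu> (rindex n))) \<cdot> (idn C ?V \<otimes> idn C ?V \<otimes> ?X)" ..
  have d: "word_obj (doubled n) \<in> obj C"
    by (rule word_obj) (use assms in \<open>auto simp: doubled_def set_rindex\<close>)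
  have "A_mult (Suc n) = (\<mu> (Suc n) \<otimes> tarrs C (map \<mu> (rindex n)))
      \<cdot> ((idn C ?V \<otimes> idn C ?V \<otimes> ?X) \<cdot> (idn C ?V \<otimes> pass n (Suc n) \<otimes> idn C (A n)))"
    using sorts_shuffle_Suc[OF assms sorts_shuffle] assms
    by (simp add: braided_tensor_mult_def[of C "Suc n"] rindex_Suc tarrs_def)
  also have "\<dots> = twisted_mult C ?V (A n) (\<mu> (Suc n)) (A_mult n) (pass n (Suc n))"
    unfolding twisted_mult_def eq using homs V d by (simp add: hom_def monoidal)
  finally show ?thesis .
qed

lemma A_unital: "n \<le> r \<Longrightarrow> unital_mult C (A n) (A_mult n) (A_unit n)"
proof (induction n)
  case 0
  show ?case
    by (simp add: unital_mult_def A_mult_0 A_unit_0 A_obj_0 hom_def monoidal)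
next
  case (Suc n)
  then interpret twisted_pair C "V (Suc n)" "A n" "\<mu> (Suc n)" "\<nu> (Suc n)" "A_mult n" "A_unit n" "pass n (Suc n)"
    by unfold_locales (use V_unital[of "Suc n"] pass_natural[of n "Suc n"] in auto)
  show ?case
    using unital Suc.prems by (simp add: A_mult_Suc A_obj_Suc A_unit_Suc)
qed

lemma twisted_pair:
  "Suc n \<le> r \<Longrightarrow> twisted_pair C (V (Suc n)) (A n) (\<mu> (Suc n)) (\<nu> (Suc n)) (A_mult n) (A_unit n) (pass n (Suc n))"
  by unfold_locales (use V_unital[of "Suc n"] pass_natural[of n "Suc n"] A_unital[of n] in auto)

end

section \<open>Compatible actions and modules over the product\<close>

context twisted_algebras
begin

text \<open>The system modules of the subsystem \<open>V\<^sub>1, \<dots>, V\<^sub>n\<close>, with the relation for \<open>i = j\<close> read as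
  associativity and without the convention on the values of \<open>\<rho>\<close> outside the index set; in this form
  they can be treated by induction on \<open>n\<close>.\<close>
definition compatible_actions :: "nat \<Rightarrow> 'o \<Rightarrow> (nat \<Rightarrow> 'm) \<Rightarrow> bool" where
  "compatible_actions n M \<rho> \<longleftrightarrow> M \<in> obj C \<and>
     (\<forall>i \<in> {1..n}. algebra_module C (V i) (\<mu> i) (\<nu> i) (M, \<rho> i)) \<and>
     (\<forall>i \<in> {1..n}. \<forall>j \<in> {1..n}. i < j \<longrightarrow> entwined C M (V j) (V i) (\<xi> i j) (\<rho> j) (\<rho> i))"

text \<open>For \<open>i = j\<close> the morphism \<open>\<xi>\<^sub>i\<^sub>,\<^sub>i = \<nu>\<^sub>i \<otimes> \<mu>\<^sub>i\<close> makes the first of the two actions one by the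
  unit, which disappears; what remains is the associativity law.\<close>
lemma system_module_iff:
  "system_module C r V \<xi> \<nu> (M, \<rho>) \<longleftrightarrow> \<rho> \<in> extensional {1..r} \<and> compatible_actions r M \<rho>"
proof -
  have diag: "\<rho> i \<cdot> (\<rho> i \<otimes> idn C (V i)) \<cdot> (idn C M \<otimes> \<xi> i i) = \<rho> i \<cdot> (idn C M \<otimes> \<mu> i)"
    if "M \<in> obj C" "i \<in> {1..r}" "\<rho> i \<in> hom C (M \<boxtimes> V i) M" "\<rho> i \<cdot> (idn C M \<otimes> \<nu> i) = idn C M" for i
  proof -
    have "(\<rho> i \<otimes> idn C (V i)) \<cdot> (idn C M \<otimes> \<nu> i \<otimes> \<mu> i) = idn C M \<otimes> \<mu> i"
      using interchange_in2[of "idn C M" "\<rho> i" "\<nu> i" "idn C (V i)" "\<mu> i"]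
        that \<mu>_hom[of i] \<nu>_hom[of i] V_obj[of i] by (simp add: hom_def monoidal)
    then show ?thesis using \<xi>_diagonal[of i] that by (simp add: sigma_Ass_def)
  qed
  have split: "(\<forall>i \<in> {1..r}. \<forall>j \<in> {1..r}. i \<le> j \<longrightarrow> P i j) \<longleftrightarrow>
     (\<forall>i \<in> {1..r}. P i i) \<and> (\<forall>i \<in> {1..r}. \<forall>j \<in> {1..r}. i < j \<longrightarrow> P i j)" for P
    by (auto simp: le_less)
  show ?thesis
    unfolding system_module_def compatible_actions_def algebra_module_def entwined_def prod.case split
    using diag by (auto simp del: atLeastAtMost_iff)
qed

text \<open>\<open>V\<^sub>n\<close>, the leftmost factor of \<open>A\<^sub>n\<close>, is adjacent to \<open>M\<close> and acts first.\<close>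
primrec act :: "nat \<Rightarrow> 'o \<Rightarrow> (nat \<Rightarrow> 'm) \<Rightarrow> 'm" where
  "act 0 M \<rho> = idn C M"
| "act (Suc n) M \<rho> = act n M \<rho> \<cdot> (\<rho> (Suc n) \<otimes> idn C (A n))"

text \<open>\<open>V\<^sub>i \<rightarrow> A\<^sub>n\<close>, with units in all other factors; meaningful for \<open>1 \<le> i \<le> n\<close>, with an arbitrary
  value at \<open>n = 0\<close>.\<close>
primrec inclusion :: "nat \<Rightarrow> nat \<Rightarrow> 'm" where
  "inclusion 0 i = idn C (tunit C)"
| "inclusion (Suc n) i =
     (if i = Suc n then idn C (V (Suc n)) \<otimes> A_unit n else \<nu> (Suc n) \<otimes> inclusion n i)"

lemma act_cong: "(\<And>i. i \<in> {1..n} \<Longrightarrow> \<rho> i = \<rho>' i) \<Longrightarrow> act n M \<rho> = act n M \<rho>'"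
  by (induction n) auto

lemma inclusion_hom: "\<lbrakk>n \<le> r; i \<in> {1..n}\<rbrakk> \<Longrightarrow> inclusion n i \<in> hom C (V i) (A n)"
proof (induction n)
  case (Suc n)
  then show ?case
    using V_obj[of "Suc n"] \<nu>_hom[of "Suc n"] A_unit_hom[of n] V_obj[of i]
    by (auto simp: hom_def A_obj_Suc typing)
qed simp

lemma act_hom:
  assumes "M \<in> obj C" "n \<le> r" "\<And>i. i \<in> {1..n} \<Longrightarrow> \<rho> i \<in> hom C (M \<boxtimes> V i) M"
  shows "act n M \<rho> \<in> hom C (M \<boxtimes> A n) M"
  using assms(2,3)
proof (induction n)
  case 0
  then show ?case using assms(1) by (simp add: A_obj_0 idn_hom typing)
next
  case (Suc n)
  then show ?case
    using Suc.prems(2)[of "Suc n"] V_obj[of "Suc n"] A_obj[of n] assms(1)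
    by (auto simp: hom_def A_obj_Suc typing)
qed

lemma entwined_act:
  assumes M: "M \<in> obj C" and j: "n < j" "j \<le> r" and \<rho>j: "\<rho> j \<in> hom C (M \<boxtimes> V j) M"
    and \<rho>: "\<And>i. i \<in> {1..n} \<Longrightarrow> \<rho> i \<in> hom C (M \<boxtimes> V i) M"
    and ent: "\<And>i. i \<in> {1..n} \<Longrightarrow> entwined C M (V j) (V i) (\<xi> i j) (\<rho> j) (\<rho> i)"
  shows "entwined C M (V j) (A n) (pass n j) (\<rho> j) (act n M \<rho>)"
  using j(1) \<rho> ent
proof (induction n)
  case 0
  then show ?case
    using M \<rho>j V_obj[of j] j by (simp add: entwined_def A_obj_0 hom_def monoidal)
next
  case (Suc n)
  interpret twist_extension C "V (Suc n)" "A n" "V j" "\<nu> (Suc n)" "A_unit n" "\<nu> j"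
    "\<xi> (Suc n) j" "pass n j"
    using Suc.prems j by (intro twist_extension) auto
  show ?case
    using entwined_twist[OF M \<rho>j, of "act n M \<rho>" "\<rho> (Suc n)"] Suc act_hom[OF M, of n \<rho>] j
    by (simp add: A_obj_Suc)
qed

lemma entwined_inclusion:
  assumes M: "M \<in> obj C" and j: "n < j" "j \<le> r" and \<rho>: "\<rho> \<in> hom C (M \<boxtimes> V j) M"
    and \<alpha>: "\<alpha> \<in> hom C (M \<boxtimes> A n) M" and ent: "entwined C M (V j) (A n) (pass n j) \<rho> \<alpha>"
    and i: "i \<in> {1..n}"
  shows "entwined C M (V j) (V i) (\<xi> i j) \<rho> (\<alpha> \<cdot> (idn C M \<otimes> inclusion n i))"
  using j(1) \<alpha> ent i
proof (induction n arbitrary: \<alpha>)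
  case (Suc n)
  interpret twist_extension C "V (Suc n)" "A n" "V j" "\<nu> (Suc n)" "A_unit n" "\<nu> j"
    "\<xi> (Suc n) j" "pass n j"
    using Suc.prems j by (intro twist_extension) auto
  note restrict = entwined_restrict[OF M \<rho>, of \<alpha>]
  show ?case
  proof (cases "i = Suc n")
    case True
    then show ?thesis using restrict(1) Suc.prems by (simp add: A_obj_Suc)
  next
    case False
    with Suc.prems have i: "i \<in> {1..n}" by auto
    define \<alpha>' where "\<alpha>' = \<alpha> \<cdot> (idn C M \<otimes> \<nu> (Suc n) \<otimes> idn C (A n))"
    have "\<alpha>' \<in> hom C (M \<boxtimes> A n) M"
      using Suc.prems M unfolding \<alpha>'_def by (simp add: hom_def A_obj_Suc data objs monoidal)
    then have "entwined C M (V j) (V i) (\<xi> i j) \<rho> (\<alpha>' \<cdot> (idn C M \<otimes> inclusion n i))"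
      using Suc.IH restrict(2) Suc.prems i unfolding \<alpha>'_def by (simp add: A_obj_Suc)
    also have "\<alpha>' \<cdot> (idn C M \<otimes> inclusion n i) = \<alpha> \<cdot> (idn C M \<otimes> inclusion (Suc n) i)"
      using inclusion_hom[OF _ i] Suc.prems M j False unfolding \<alpha>'_def
      by (simp add: hom_def A_obj_Suc data objs monoidal interchange point_cmp)
    finally show ?thesis .
  qed
qed simp

lemma algebra_module_hom: "algebra_module C B m u (M, \<alpha>) \<Longrightarrow> \<alpha> \<in> hom C (M \<boxtimes> B) M"
  and algebra_module_unit: "algebra_module C B m u (M, \<alpha>) \<Longrightarrow> \<alpha> \<cdot> (idn C M \<otimes> u) = idn C M"
  by (auto simp: algebra_module_def)

lemma compatible_actions_hom:
  "compatible_actions n M \<rho> \<Longrightarrow> i \<in> {1..n} \<Longrightarrow> \<rho> i \<in> hom C (M \<boxtimes> V i) M"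
  by (auto simp: compatible_actions_def dest: algebra_module_hom)

lemma algebra_module_act:
  "\<lbrakk>n \<le> r; compatible_actions n M \<rho>\<rbrakk>
    \<Longrightarrow> algebra_module C (A n) (A_mult n) (A_unit n) (M, act n M \<rho>)"
proof (induction n)
  case 0
  then show ?case
    by (simp add: compatible_actions_def algebra_module_def A_obj_0 A_mult_0 A_unit_0 hom_def monoidal)
next
  case (Suc n)
  interpret twisted_pair C "V (Suc n)" "A n" "\<mu> (Suc n)" "\<nu> (Suc n)" "A_mult n" "A_unit n"
    "pass n (Suc n)"
    using Suc.prems by (intro twisted_pair)
  have comp: "compatible_actions n M \<rho>"
    using Suc.prems by (auto simp: compatible_actions_def)
  have "entwined C M (V (Suc n)) (A n) (pass n (Suc n)) (\<rho> (Suc n)) (act n M \<rho>)"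
    using Suc.prems compatible_actions_hom[OF Suc.prems(2)]
    by (intro entwined_act) (auto simp: compatible_actions_def)
  then show ?case
    using module_of_pair[of M "\<rho> (Suc n)" "act n M \<rho>"] Suc comp
    by (auto simp: compatible_actions_def A_mult_Suc A_unit_Suc A_obj_Suc)
qed

lemma act_inclusion:
  "\<lbrakk>n \<le> r; compatible_actions n M \<rho>; i \<in> {1..n}\<rbrakk>
    \<Longrightarrow> act n M \<rho> \<cdot> (idn C M \<otimes> inclusion n i) = \<rho> i"
proof (induction n)
  case (Suc n)
  interpret twisted_pair C "V (Suc n)" "A n" "\<mu> (Suc n)" "\<nu> (Suc n)" "A_mult n" "A_unit n"
    "pass n (Suc n)"
    using Suc.prems by (intro twisted_pair)
  have comp: "compatible_actions n M \<rho>" and M: "M \<in> obj C"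
    and top: "algebra_module C (V (Suc n)) (\<mu> (Suc n)) (\<nu> (Suc n)) (M, \<rho> (Suc n))"
    using Suc.prems by (auto simp: compatible_actions_def)
  note act = algebra_module_act[OF _ comp]
  note restrict = restrict_pair[OF algebra_module_hom[OF top] algebra_module_unit[OF top]
      algebra_module_hom[OF act] algebra_module_unit[OF act] M]
  show ?case
  proof (cases "i = Suc n")
    case True
    then show ?thesis using restrict(1) Suc.prems by simp
  next
    case False
    with Suc.prems have i: "i \<in> {1..n}" by auto
    have homs: "\<rho> (Suc n) \<in> hom C (M \<boxtimes> V (Suc n)) M" "act n M \<rho> \<in> hom C (M \<boxtimes> A n) M"
      "inclusion n i \<in> hom C (V i) (A n)"
      using algebra_module_hom[OF top] algebra_module_hom[OF act] inclusion_hom[OF _ i] Suc.prems by auto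
    have "act (Suc n) M \<rho> \<cdot> (idn C M \<otimes> inclusion (Suc n) i)
      = ((act n M \<rho> \<cdot> (\<rho> (Suc n) \<otimes> idn C (A n))) \<cdot> (idn C M \<otimes> \<nu> (Suc n) \<otimes> idn C (A n)))
        \<cdot> (idn C M \<otimes> inclusion n i)"
      using homs M False V_obj[of i] Suc.prems by (simp add: hom_def data monoidal interchange point_cmp)
    also have "\<dots> = \<rho> i"
      using restrict(2) Suc.IH comp i Suc.prems by simp
    finally show ?thesis .
  qed
qed simp

text \<open>The \<open>A\<^sub>n\<^sub>+\<^sub>1\<close>-action \<open>\<alpha>\<close> is split into an action of \<open>V\<^sub>n\<^sub>+\<^sub>1\<close> and an action \<open>\<alpha>'\<close> of \<open>A\<^sub>n\<close>; the
  inclusion of a lower factor \<open>V\<^sub>i\<close> into \<open>A\<^sub>n\<^sub>+\<^sub>1\<close> runs through \<open>A\<^sub>n\<close>, so the remaining actions are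
  the restrictions of \<open>\<alpha>'\<close>.\<close>
lemma module_restrict:
  "\<lbrakk>n \<le> r; algebra_module C (A n) (A_mult n) (A_unit n) (M, \<alpha>)\<rbrakk>
    \<Longrightarrow> compatible_actions n M (\<lambda>i. \<alpha> \<cdot> (idn C M \<otimes> inclusion n i))
      \<and> act n M (\<lambda>i. \<alpha> \<cdot> (idn C M \<otimes> inclusion n i)) = \<alpha>"
proof (induction n arbitrary: \<alpha>)
  case 0
  then show ?case
    by (auto simp: compatible_actions_def algebra_module_def A_obj_0 A_unit_0 hom_def monoidal)
next
  case (Suc n)
  interpret twisted_pair C "V (Suc n)" "A n" "\<mu> (Suc n)" "\<nu> (Suc n)" "A_mult n" "A_unit n"
    "pass n (Suc n)"
    using Suc.prems by (intro twisted_pair)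
  define \<rho> where "\<rho> = (\<lambda>i. \<alpha> \<cdot> (idn C M \<otimes> inclusion (Suc n) i))"
  define \<alpha>' where "\<alpha>' = \<alpha> \<cdot> (idn C M \<otimes> \<nu> (Suc n) \<otimes> idn C (A n))"
  have M: "M \<in> obj C" and \<alpha>: "\<alpha> \<in> hom C (M \<boxtimes> A (Suc n)) M"
    using Suc.prems by (auto simp: algebra_module_def)
  have top: "\<rho> (Suc n) = \<alpha> \<cdot> (idn C M \<otimes> idn C (V (Suc n)) \<otimes> A_unit n)"
    by (simp add: \<rho>_def)
  have lower: "\<rho> i = \<alpha>' \<cdot> (idn C M \<otimes> inclusion n i)" if i: "i \<in> {1..n}" for i
    using inclusion_hom[OF _ i] Suc.prems M \<alpha> i unfolding \<alpha>'_def \<rho>_def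
    by (simp add: hom_def A_obj_Suc data monoidal interchange point_cmp)
  have "algebra_module C (V (Suc n) \<boxtimes> A n) mult (\<nu> (Suc n) \<otimes> A_unit n) (M, \<alpha>)"
    using Suc.prems by (simp add: A_mult_Suc A_unit_Suc A_obj_Suc)
  note pair = pair_of_module[OF this, folded \<alpha>'_def top]
  note IH = Suc.IH[OF _ pair(2)]
  have "act n M \<rho> = \<alpha>'"
    using IH act_cong[of n \<rho> "\<lambda>i. \<alpha>' \<cdot> (idn C M \<otimes> inclusion n i)"] lower Suc.prems by simp
  then have "act (Suc n) M \<rho> = \<alpha>"
    using pair(3) by simp
  moreover have "entwined C M (V (Suc n)) (V i) (\<xi> i (Suc n)) (\<rho> (Suc n)) (\<rho> i)" if "i \<in> {1..n}" for i
    using entwined_inclusion[OF M _ _ algebra_module_hom[OF pair(1)] algebra_module_hom[OF pair(2)] pair(4) that]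
      lower[OF that] Suc.prems by simp
  moreover have "compatible_actions n M \<rho>"
    using IH lower Suc.prems by (simp add: compatible_actions_def)
  ultimately show ?case
    using pair(1) unfolding \<rho>_def[symmetric]
    by (auto simp: compatible_actions_def atLeastAtMostSuc_conv)
qed

lemma act_natural:
  assumes "M \<in> obj C" "N \<in> obj C" "f \<in> hom C M N" "n \<le> r"
    and "\<And>i. i \<in> {1..n} \<Longrightarrow> \<rho> i \<in> hom C (M \<boxtimes> V i) M"
    and "\<And>i. i \<in> {1..n} \<Longrightarrow> \<sigma> i \<in> hom C (N \<boxtimes> V i) N"
    and "\<And>i. i \<in> {1..n} \<Longrightarrow> f \<cdot> \<rho> i = \<sigma> i \<cdot> (f \<otimes> idn C (V i))"
  shows "f \<cdot> act n M \<rho> = act n N \<sigma> \<cdot> (f \<otimes> idn C (A n))"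
  using assms(4-)
proof (induction n)
  case 0
  then show ?case using assms by (simp add: A_obj_0 hom_def monoidal)
next
  case (Suc n)
  let ?A = "idn C (A n)" and ?V = "idn C (V (Suc n))"
  have homs: "\<rho> (Suc n) \<in> hom C (M \<boxtimes> V (Suc n)) M" "\<sigma> (Suc n) \<in> hom C (N \<boxtimes> V (Suc n)) N"
    "act n M \<rho> \<in> hom C (M \<boxtimes> A n) M" "act n N \<sigma> \<in> hom C (N \<boxtimes> A n) N"
    "V (Suc n) \<in> obj C" "A n \<in> obj C"
    using Suc.prems assms act_hom V_obj A_obj by auto
  have "f \<cdot> act (Suc n) M \<rho> = (f \<cdot> act n M \<rho>) \<cdot> (\<rho> (Suc n) \<otimes> ?A)"
    using homs assms(1-3) by (simp add: hom_def monoidal)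
  also have "\<dots> = act n N \<sigma> \<cdot> (f \<otimes> ?A) \<cdot> (\<rho> (Suc n) \<otimes> ?A)"
    using Suc homs assms(1-3) by (simp add: hom_def monoidal)
  also have "(f \<otimes> ?A) \<cdot> (\<rho> (Suc n) \<otimes> ?A) = (f \<cdot> \<rho> (Suc n)) \<otimes> ?A"
    using homs assms(1-3) by (simp add: hom_def monoidal interchange)
  also have "\<dots> = (\<sigma> (Suc n) \<cdot> (f \<otimes> ?V)) \<otimes> ?A"
    using Suc.prems(4)[of "Suc n"] by simp
  also have "\<dots> = (\<sigma> (Suc n) \<otimes> ?A) \<cdot> (f \<otimes> ?V \<otimes> ?A)"
    using homs assms(1-3) interchange[of "f \<otimes> ?V" "\<sigma> (Suc n)" ?A ?A] by (simp add: hom_def monoidal)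
  also have "act n N \<sigma> \<cdot> \<dots> = act (Suc n) N \<sigma> \<cdot> (f \<otimes> idn C (A (Suc n)))"
    using homs assms(1-3) by (simp add: hom_def A_obj_Suc monoidal)
  finally show ?case .
qed

lemma restrict_natural:
  assumes "M \<in> obj C" "N \<in> obj C" "f \<in> hom C M N" "n \<le> r" "i \<in> {1..n}"
    and "\<alpha> \<in> hom C (M \<boxtimes> A n) M" "\<beta> \<in> hom C (N \<boxtimes> A n) N"
    and eq: "f \<cdot> \<alpha> = \<beta> \<cdot> (f \<otimes> idn C (A n))"
  shows "f \<cdot> (\<alpha> \<cdot> (idn C M \<otimes> inclusion n i)) = (\<beta> \<cdot> (idn C N \<otimes> inclusion n i)) \<cdot> (f \<otimes> idn C (V i))"
proof -
  note homs = assms(1-3,6,7) inclusion_hom[OF assms(4,5)] V_obj[of i] A_obj[OF assms(4)]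
  have "f \<cdot> (\<alpha> \<cdot> (idn C M \<otimes> inclusion n i)) = (f \<cdot> \<alpha>) \<cdot> (idn C M \<otimes> inclusion n i)"
    using homs by (simp add: hom_def monoidal)
  also have "\<dots> = \<beta> \<cdot> (f \<otimes> inclusion n i)"
    unfolding eq using homs by (simp add: hom_def monoidal interchange)
  also have "\<dots> = (\<beta> \<cdot> (idn C N \<otimes> inclusion n i)) \<cdot> (f \<otimes> idn C (V i))"
    using homs assms(4,5) by (simp add: hom_def monoidal interchange)
  finally show ?thesis .
qed

end

section \<open>Categories of structured objects\<close>

text \<open>Objects of a category with additional structure, and the morphisms of that category that
  respect it.  Both module categories have this form, over the same base.\<close>
definition structured_cat ::
  "('o, 'm, 'z) cat_scheme \<Rightarrow> ('o \<times> 's \<Rightarrow> bool) \<Rightarrow> ('o \<times> 's \<Rightarrow> 'm \<Rightarrow> 'o \<times> 's \<Rightarrow> bool)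
    \<Rightarrow> ('o \<times> 's, ('o \<times> 's) \<times> 'm \<times> ('o \<times> 's)) cat" where
  "structured_cat C P Q =
    \<lparr> obj = {X. P X},
      arr = {(X, f, Y). P X \<and> P Y \<and> f \<in> hom C (fst X) (fst Y) \<and> Q X f Y},
      src = (\<lambda>(X, f, Y). X),
      tgt = (\<lambda>(X, f, Y). Y),
      idn = (\<lambda>X. (X, idn C (fst X), X)),
      cmp = (\<lambda>(_, g, Z) (X, f, _). (X, g \<cdot>\<^bsub>C\<^esub> f, Z)) \<rparr>"

lemma structured_cat_simps:
  "obj (structured_cat C P Q) = {X. P X}"
  "(X, f, Y) \<in> arr (structured_cat C P Q) \<longleftrightarrow> P X \<and> P Y \<and> f \<in> hom C (fst X) (fst Y) \<and> Q X f Y"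
  "src (structured_cat C P Q) (X, f, Y) = X"
  "tgt (structured_cat C P Q) (X, f, Y) = Y"
  "idn (structured_cat C P Q) X = (X, idn C (fst X), X)"
  "(Y', g, Z) \<cdot>\<^bsub>structured_cat C P Q\<^esub> (X, f, Y) = (X, g \<cdot>\<^bsub>C\<^esub> f, Z)"
  by (simp_all add: structured_cat_def)

lemma hom_structured_cat:
  "hom (structured_cat C P Q) X Y =
    {(X', f, Y'). X' = X \<and> Y' = Y \<and> P X \<and> P Y \<and> f \<in> hom C (fst X) (fst Y) \<and> Q X f Y}"
  by (auto simp: hom_def structured_cat_def)

lemma structured_cat_category:
  assumes "category C" and "\<And>X. P X \<Longrightarrow> fst X \<in> obj C"
    and "\<And>X. P X \<Longrightarrow> Q X (idn C (fst X)) X"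
    and "\<And>X Y Z f g. \<lbrakk>P X; P Y; P Z; f \<in> hom C (fst X) (fst Y); g \<in> hom C (fst Y) (fst Z);
      Q X f Y; Q Y g Z\<rbrakk> \<Longrightarrow> Q X (g \<cdot>\<^bsub>C\<^esub> f) Z"
  shows "category (structured_cat C P Q)"
proof -
  interpret category C by fact
  show ?thesis
    by unfold_locales
      (use assms(2-) in \<open>auto simp: hom_structured_cat idn_hom cmp_hom cmp_idn_left cmp_idn_right
        cmp_assoc structured_cat_simps\<close>)
qed

text \<open>A pair of maps that is the identity on the objects and arrows of the category, but possibly not
  outside, is a functor isomorphic to the identity.\<close>
lemma natural_iso_identity:
  assumes "category C" and "\<And>a. a \<in> obj C \<Longrightarrow> Fo a = a" and "\<And>f. f \<in> arr C \<Longrightarrow> Fa f = f"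
  shows "is_natural_iso C C (\<lambda>a. a) (\<lambda>f. f) Fo Fa (idn C)"
    and "is_natural_iso C C Fo Fa (\<lambda>a. a) (\<lambda>f. f) (idn C)"
proof -
  interpret category C by fact
  have functors: "is_functor C C Fo Fa" "is_functor C C (\<lambda>a. a) (\<lambda>f. f)"
    using assms src_obj tgt_obj idn_hom cmp_hom unfolding is_functor_def hom_def
    by simp_all
  have iso: "is_iso C (idn C a)" if "a \<in> obj C" for a
    using idn_hom[OF that] cmp_idn_left[OF idn_hom[OF that]]
    by (auto simp: is_iso_def hom_def)
  have unit: "idn C (tgt C f) \<cdot>\<^bsub>C\<^esub> f = f \<cdot>\<^bsub>C\<^esub> idn C (src C f)" if "f \<in> arr C" for f
    using cmp_idn_left[of f "src C f" "tgt C f"] cmp_idn_right[of f "src C f" "tgt C f"] that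
    by (simp add: hom_def)
  show "is_natural_iso C C (\<lambda>a. a) (\<lambda>f. f) Fo Fa (idn C)"
    "is_natural_iso C C Fo Fa (\<lambda>a. a) (\<lambda>f. f) (idn C)"
    using functors iso unit idn_hom assms unfolding is_natural_iso_def by simp_all
qed

text \<open>Mutually inverse translations of structures over the same objects, for which the same morphisms
  are structure preserving, give an isomorphism of categories; the natural isomorphisms are
  identities.\<close>
lemma structured_cat_equivalent:
  fixes Fo :: "'o \<times> 's \<Rightarrow> 'o \<times> 't"
  assumes cats: "category (structured_cat C P Q)" "category (structured_cat C P' Q')"
    and Fo: "\<And>X. P X \<Longrightarrow> P' (Fo X) \<and> fst (Fo X) = fst X \<and> Go (Fo X) = X"
    and Go: "\<And>Y. P' Y \<Longrightarrow> P (Go Y) \<and> fst (Go Y) = fst Y \<and> Fo (Go Y) = Y"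
    and FQ: "\<And>X Y f. \<lbrakk>P X; P Y; f \<in> hom C (fst X) (fst Y); Q X f Y\<rbrakk> \<Longrightarrow> Q' (Fo X) f (Fo Y)"
    and GQ: "\<And>X Y f. \<lbrakk>P' X; P' Y; f \<in> hom C (fst X) (fst Y); Q' X f Y\<rbrakk> \<Longrightarrow> Q (Go X) f (Go Y)"
  shows "equivalent_categories (structured_cat C P Q) (structured_cat C P' Q')"
proof -
  let ?Fa = "\<lambda>(X, f, Y). (Fo X, f, Fo Y)" and ?Ga = "\<lambda>(X, f, Y). (Go X, f, Go Y)"
  let ?C = "structured_cat C P Q" and ?D = "structured_cat C P' Q'"
  have F: "is_functor ?C ?D Fo ?Fa"
    unfolding is_functor_def hom_structured_cat using cats Fo FQ by (auto simp: structured_cat_def)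
  have G: "is_functor ?D ?C Go ?Ga"
    unfolding is_functor_def hom_structured_cat using cats Go GQ by (auto simp: structured_cat_def)
  have GF: "is_natural_iso ?C ?C (\<lambda>a. a) (\<lambda>f. f) (Go \<circ> Fo) (?Ga \<circ> ?Fa) (idn ?C)"
    by (rule natural_iso_identity) (use cats Fo in \<open>auto simp: structured_cat_def\<close>)
  have FG: "is_natural_iso ?D ?D (Fo \<circ> Go) (?Fa \<circ> ?Ga) (\<lambda>a. a) (\<lambda>f. f) (idn ?D)"
    by (rule natural_iso_identity) (use cats Go in \<open>auto simp: structured_cat_def\<close>)
  show ?thesis
    unfolding equivalent_categories_def using F G GF FG by blast
qed

section \<open>Equivalence of the module categories\<close>

lemma (in strict_monoidal_category) action_morphisms_compose:
  assumes "f \<in> hom C M N" "g \<in> hom C N L" "B \<in> obj C" "M \<in> obj C" "N \<in> obj C" "L \<in> obj C"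
    and "\<alpha> \<in> hom C (M \<boxtimes> B) M" "\<beta> \<in> hom C (N \<boxtimes> B) N" "\<gamma> \<in> hom C (L \<boxtimes> B) L"
    and "f \<cdot> \<alpha> = \<beta> \<cdot> (f \<otimes> idn C B)" "g \<cdot> \<beta> = \<gamma> \<cdot> (g \<otimes> idn C B)"
  shows "(g \<cdot> f) \<cdot> \<alpha> = \<gamma> \<cdot> ((g \<cdot> f) \<otimes> idn C B)"
proof -
  note homs = assms(1-9)[unfolded hom_def, simplified]
  have "(g \<cdot> f) \<cdot> \<alpha> = (g \<cdot> \<beta>) \<cdot> (f \<otimes> idn C B)"
    using assms(10) by (simp add: homs monoidal)
  also have "\<dots> = \<gamma> \<cdot> ((g \<cdot> f) \<otimes> idn C B)"
    unfolding assms(11) by (simp add: homs monoidal interchange)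
  finally show ?thesis .
qed

context twisted_algebras
begin

abbreviation system_morphism where
  "system_morphism \<equiv> (\<lambda>X f Y. \<forall>i \<in> {1..r}. f \<cdot> snd X i = snd Y i \<cdot> (f \<otimes> idn C (V i)))"

abbreviation algebra_morphism where
  "algebra_morphism \<equiv> (\<lambda>X f Y. f \<cdot> snd X = snd Y \<cdot> (f \<otimes> idn C (A r)))"

lemma system_module_cat_structured:
  "system_module_cat C r V \<xi> \<nu> = structured_cat C (system_module C r V \<xi> \<nu>) system_morphism"
  unfolding system_module_cat_def structured_cat_def by simp

lemma algebra_module_cat_structured:
  "algebra_module_cat C (A r) (A_mult r) (A_unit r)
    = structured_cat C (algebra_module C (A r) (A_mult r) (A_unit r)) algebra_morphism"
  unfolding algebra_module_cat_def structured_cat_def by simp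

lemma system_module_homs:
  assumes "system_module C r V \<xi> \<nu> X" "i \<in> {1..r}"
  shows "snd X i \<in> hom C (fst X \<boxtimes> V i) (fst X)"
  using assms by (auto simp: system_module_def)

lemma category_system_modules: "category (system_module_cat C r V \<xi> \<nu>)"
  unfolding system_module_cat_structured
proof (rule structured_cat_category)
  show "category C" ..
  show obj: "fst X \<in> obj C" if "system_module C r V \<xi> \<nu> X" for X
    using that by (auto simp: system_module_def)
  show "system_morphism X (idn C (fst X)) X" if "system_module C r V \<xi> \<nu> X" for X
    using system_module_homs[OF that] obj[OF that] V_obj by (simp add: hom_def monoidal)
  show "system_morphism X (g \<cdot> f) Z"
    if "system_module C r V \<xi> \<nu> X" "system_module C r V \<xi> \<nu> Y" "system_module C r V \<xi> \<nu> Z"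
      "f \<in> hom C (fst X) (fst Y)" "g \<in> hom C (fst Y) (fst Z)"
      "system_morphism X f Y" "system_morphism Y g Z" for X Y Z f g
  proof
    fix i assume i: "i \<in> {1..r}"
    show "(g \<cdot> f) \<cdot> snd X i = snd Z i \<cdot> ((g \<cdot> f) \<otimes> idn C (V i))"
      by (rule action_morphisms_compose[OF that(4,5) V_obj[OF i] obj obj obj
            system_module_homs[OF that(1) i] system_module_homs[OF that(2) i]
            system_module_homs[OF that(3) i]])
        (use that i in auto)
  qed
qed

lemma category_algebra_modules: "category (algebra_module_cat C (A r) (A_mult r) (A_unit r))"
  unfolding algebra_module_cat_structured
proof (rule structured_cat_category)
  let ?P = "algebra_module C (A r) (A_mult r) (A_unit r)"
  show "category C" ..
  show obj: "fst X \<in> obj C" if "?P X" for X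
    using that by (auto simp: algebra_module_def)
  have act: "snd X \<in> hom C (fst X \<boxtimes> A r) (fst X)" if "?P X" for X
    using that by (auto simp: algebra_module_def)
  show "algebra_morphism X (idn C (fst X)) X" if "?P X" for X
    using act[OF that] obj[OF that] A_obj[of r] by (simp add: hom_def monoidal)
  show "algebra_morphism X (g \<cdot> f) Z"
    if "?P X" "?P Y" "?P Z" "f \<in> hom C (fst X) (fst Y)" "g \<in> hom C (fst Y) (fst Z)"
      "algebra_morphism X f Y" "algebra_morphism Y g Z" for X Y Z f g
    by (rule action_morphisms_compose[OF that(4,5) A_obj obj obj obj act act act that(6,7)])
      (use that in auto)
qed

theorem modules_equivalent:
  "equivalent_categories (system_module_cat C r V \<xi> \<nu>) (algebra_module_cat C (A r) (A_mult r) (A_unit r))"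
  unfolding system_module_cat_structured algebra_module_cat_structured
proof (rule structured_cat_equivalent[OF category_system_modules[unfolded system_module_cat_structured]
      category_algebra_modules[unfolded algebra_module_cat_structured]])
  let ?F = "\<lambda>(M, \<rho>). (M, act r M \<rho>)"
  let ?G = "\<lambda>(M, \<alpha>). (M, \<lambda>i \<in> {1..r}. \<alpha> \<cdot> (idn C M \<otimes> inclusion r i))"
  let ?P = "algebra_module C (A r) (A_mult r) (A_unit r)"
  show "?P (?F X) \<and> fst (?F X) = fst X \<and> ?G (?F X) = X" if "system_module C r V \<xi> \<nu> X" for X
  proof (cases X)
    case (Pair M \<rho>)
    then have \<rho>: "\<rho> \<in> extensional {1..r}" "compatible_actions r M \<rho>"
      using that by (simp_all add: system_module_iff)
    then have "(\<lambda>i \<in> {1..r}. act r M \<rho> \<cdot> (idn C M \<otimes> inclusion r i)) = \<rho>"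
      by (intro extensionalityI[where A = "{1..r}"]) (auto simp: act_inclusion)
    with \<rho> Pair show ?thesis by (simp add: algebra_module_act)
  qed
  show "system_module C r V \<xi> \<nu> (?G Y) \<and> fst (?G Y) = fst Y \<and> ?F (?G Y) = Y" if "?P Y" for Y
  proof (cases Y)
    case (Pair M \<alpha>)
    let ?\<rho> = "\<lambda>i. \<alpha> \<cdot> (idn C M \<otimes> inclusion r i)"
    have \<rho>: "compatible_actions r M ?\<rho>" "act r M ?\<rho> = \<alpha>"
      using module_restrict[of r M \<alpha>] that Pair by simp_all
    moreover have "compatible_actions r M (restrict ?\<rho> {1..r})"
      using \<rho>(1) unfolding compatible_actions_def by simp
    moreover have "act r M (restrict ?\<rho> {1..r}) = act r M ?\<rho>"
      by (rule act_cong) simp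
    ultimately show ?thesis
      using Pair by (simp add: system_module_iff)
  qed
  show "algebra_morphism (?F X) f (?F Y)"
    if "system_module C r V \<xi> \<nu> X" "system_module C r V \<xi> \<nu> Y" "f \<in> hom C (fst X) (fst Y)"
      "system_morphism X f Y" for X Y f
    using act_natural[of "fst X" "fst Y" f r "snd X" "snd Y"] that system_module_homs[OF that(1)]
      system_module_homs[OF that(2)]
    by (auto simp: system_module_def split: prod.splits)
  show "system_morphism (?G X) f (?G Y)"
    if "?P X" "?P Y" "f \<in> hom C (fst X) (fst Y)" "algebra_morphism X f Y" for X Y f
    using restrict_natural[of "fst X" "fst Y" f r _ "snd X" "snd Y"] that
    by (auto simp: algebra_module_def split: prod.splits)
qed

end

theorem proposition4p10:
  fixes C :: "('o, 'm) moncat"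
    and r :: nat
    and V :: "nat \<Rightarrow> 'o"
    and \<mu> \<nu> \<epsilon> :: "nat \<Rightarrow> 'm"
    and \<xi> :: "nat \<Rightarrow> nat \<Rightarrow> 'm"
  assumes "strict_monoidal_category C"
    and "r \<ge> 1"
    and "\<And>i. i \<in> {1..r} \<Longrightarrow> unital_assoc_algebra C (V i) (\<mu> i) (\<nu> i)"
    and "\<And>i. i \<in> {1..r} \<Longrightarrow> normalized_pair C (V i) (\<nu> i) (\<epsilon> i)"
    and "\<And>i j. \<lbrakk>1 \<le> i; i < j; j \<le> r\<rbrakk> \<Longrightarrow> \<xi> i j \<in> hom C (V i \<boxtimes>\<^bsub>C\<^esub> V j) (V j \<boxtimes>\<^bsub>C\<^esub> V i)"
    and "\<And>i j. \<lbrakk>1 \<le> i; i < j; j \<le> r\<rbrakk> \<Longrightarrow> \<xi> i j \<cdot>\<^bsub>C\<^esub> (\<nu> i \<otimes>\<^bsub>C\<^esub> idn C (V j)) = idn C (V j) \<otimes>\<^bsub>C\<^esub> \<nu> i"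
    and "\<And>i j. \<lbrakk>1 \<le> i; i < j; j \<le> r\<rbrakk> \<Longrightarrow> \<xi> i j \<cdot>\<^bsub>C\<^esub> (idn C (V i) \<otimes>\<^bsub>C\<^esub> \<nu> j) = \<nu> j \<otimes>\<^bsub>C\<^esub> idn C (V i)"
    and "\<And>i. i \<in> {1..r} \<Longrightarrow> \<xi> i i = sigma_Ass C (\<mu> i) (\<nu> i)"
    and "pointed_braided_system C r V \<xi> \<nu>"
  shows "equivalent_categories
           (system_module_cat C r V \<xi> \<nu>)
           (algebra_module_cat C (braided_tensor_obj C r V)
              (braided_tensor_mult C r V \<xi> \<mu>) (braided_tensor_unit C r \<nu>))"
proof -
  interpret strict_monoidal_category C by fact
  interpret twisted_algebras C r V \<mu> \<nu> \<xi>
    by unfold_locales (use assms in blast)+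
  show ?thesis by (rule modules_equivalent)
qed

end
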